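(* Let $H$ be a finite-dimensional Hopf algebra, $X$ an algebra, $\alpha:X\to X\otimes H$ a right coaction of $H$ on $X$ and $\beta:X\to\widehat H\otimes X$ a left coaction of $\widehat H$ on $X$. Then $(X,\alpha,\beta)$ is a right-left $(H,\widehat H)$-Yetter--Drinfeld algebra if and only if $(X,\lhd_\beta,\alpha)$ is a (right-right) Yetter--Drinfeld algebra over $H$, where $\lhd_\beta:X\otimes H\to X$, $x\lhd_\beta h=(\mathbf p(h,\cdot)\otimes\mathrm{id}_X)(\beta(x))$, is the right action of $H$ on $X$ induced by $\beta$.
   Context: $\Bbbk$ is a field, algebras are unital $\Bbbk$-algebras. $H$ has structure maps $\Delta,\varepsilon,S$ ($S$ bijective), with Sweedler notation; $\widehat H$ is the dual Hopf algebra and $\mathbf p(h,\theta)=\theta(h)$, with $\mathbf p(h,\theta\theta')=\mathbf p(h_{(1)},\theta)\mathbf p(h_{(2)},\theta')$, $\mathbf p(hh',\theta)=\mathbf p(h,\theta_{(1)})\mathbf p(h',\theta_{(2)})$. $U=\sum_ih_i\otimes\widehat h_i\in H\otimes\widehat H$ (dual bases) is the canonical element, invertible with $U^{-1}=(S\otimes\mathrm{id})(U)$. $\Sigma$ is the flip, so $\Sigma(U)\in\widehat H\otimes H$; $\Sigma(U)^{-1}_{13}\in\widehat H\otimes X\otimes H$ is $\Sigma(U)^{-1}$ placed in legs 1 and 3. $\mathrm{Ad}(W)(z)=WzW^{-1}$. A left coaction of a Hopf algebra $K$ on an algebra $X$ is an algebra homomorphism $\beta:X\to K\otimes X$ with $(\mathrm{id}\otimes\beta)\beta=(\Delta_K\otimes\mathrm{id})\beta$,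 $(\varepsilon_K\otimes\mathrm{id})\beta=\mathrm{id}$; right coactions $X\to X\otimes K$ are defined similarly. A right action of $H$ on $X$ is a right module structure $\lhd$ with $(xy)\lhd h=(x\lhd h_{(1)})(y\lhd h_{(2)})$, $1_X\lhd h=\varepsilon(h)1_X$. $(X,\alpha,\beta)$ is a right-left $(H,\widehat H)$-Yetter--Drinfeld algebra if $(\mathrm{id}_{\widehat H}\otimes\alpha)\beta=\mathrm{Ad}(\Sigma(U)^{-1}_{13})(\beta\otimes\mathrm{id}_H)\alpha$. For a right action $\lhd$ and a right coaction $\delta(x)=x_{[0]}\otimes x_{[1]}$ of $H$ on $X$, $(X,\lhd,\delta)$ is a (right-right) Yetter--Drinfeld algebra over $H$ if $(x_{[0]}\lhd h_{(1)})\otimes x_{[1]}h_{(2)}=(x\lhd h_{(2)})_{[0]}\otimes h_{(1)}(x\lhd h_{(2)})_{[1]}$ for all $h\in H$, $x\in X$. *)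

theory Defs
  imports "HOL-Algebra.Module" "HOL-Algebra.AbelCoset"
begin

section \<open>Linear algebra over a field\<close>

text \<open>
  The ground field is a record \<open>R\<close>; vector spaces and algebras over it are
  \<open>module\<close> records, whose multiplicative fields are meaningless for bare vector spaces.
  All maps are only significant on the carriers.
\<close>

locale unital_algebra = module R A + A: ring A for R (structure) and A (structure) +
  assumes smult_mult_left:
      "\<lbrakk>a \<in> carrier R; x \<in> carrier A; y \<in> carrier A\<rbrakk> \<Longrightarrow>
        (a \<odot>\<^bsub>A\<^esub> x) \<otimes>\<^bsub>A\<^esub> y = a \<odot>\<^bsub>A\<^esub> (x \<otimes>\<^bsub>A\<^esub> y)"
    and smult_mult_right:
      "\<lbrakk>a \<in> carrier R; x \<in> carrier A; y \<in> carrier A\<rbrakk> \<Longrightarrow>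
        x \<otimes>\<^bsub>A\<^esub> (a \<odot>\<^bsub>A\<^esub> y) = a \<odot>\<^bsub>A\<^esub> (x \<otimes>\<^bsub>A\<^esub> y)"

definition base_algebra :: "('k, 'r) ring_scheme \<Rightarrow> ('k, 'k) module" where
  "base_algebra R = \<lparr>carrier = carrier R, monoid.mult = (\<otimes>\<^bsub>R\<^esub>), one = \<one>\<^bsub>R\<^esub>,
     zero = \<zero>\<^bsub>R\<^esub>, add = (\<oplus>\<^bsub>R\<^esub>), smult = (\<otimes>\<^bsub>R\<^esub>)\<rparr>"

definition lin_map ::
  "('k, 'r) ring_scheme \<Rightarrow> ('k, 'm, 'a) module_scheme \<Rightarrow> ('k, 'n, 'b) module_scheme \<Rightarrow> ('m \<Rightarrow> 'n) set"
where
  "lin_map R M N = {f. f \<in> carrier M \<rightarrow> carrier N \<and>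
     (\<forall>x\<in>carrier M. \<forall>y\<in>carrier M. f (x \<oplus>\<^bsub>M\<^esub> y) = f x \<oplus>\<^bsub>N\<^esub> f y) \<and>
     (\<forall>a\<in>carrier R. \<forall>x\<in>carrier M. f (a \<odot>\<^bsub>M\<^esub> x) = a \<odot>\<^bsub>N\<^esub> f x)}"

definition alg_hom ::
  "('k, 'r) ring_scheme \<Rightarrow> ('k, 'm, 'a) module_scheme \<Rightarrow> ('k, 'n, 'b) module_scheme \<Rightarrow> ('m \<Rightarrow> 'n) set"
where
  "alg_hom R A B = lin_map R A B \<inter> ring_hom A B"

definition finite_basis ::
  "('k, 'r) ring_scheme \<Rightarrow> ('k, 'm, 'a) module_scheme \<Rightarrow> 'm set \<Rightarrow> bool"
where
  "finite_basis R M B \<longleftrightarrow> finite B \<and> B \<subseteq> carrier M \<and>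
     (\<forall>x\<in>carrier M. \<exists>!c. c \<in> B \<rightarrow>\<^sub>E carrier R \<and> x = (\<Oplus>\<^bsub>M\<^esub>b\<in>B. c b \<odot>\<^bsub>M\<^esub> b))"

definition finite_dimensional ::
  "('k, 'r) ring_scheme \<Rightarrow> ('k, 'm, 'a) module_scheme \<Rightarrow> bool"
where
  "finite_dimensional R M \<longleftrightarrow> (\<exists>B. finite_basis R M B)"


section \<open>Tensor products\<close>

text \<open>
  The tensor product is the free module on the set of pairs modulo the submodule generated by
  the bilinearity relations; its elements are cosets.
\<close>

definition free_module :: "('k, 'r) ring_scheme \<Rightarrow> 's set \<Rightarrow> ('k, 's \<Rightarrow> 'k) module" where
  "free_module R S =
     \<lparr>carrier = {f. (\<forall>s\<in>S. f s \<in> carrier R) \<and> (\<forall>s. s \<notin> S \<longrightarrow> f s = \<zero>\<^bsub>R\<^esub>) \<and> finite {s. f s \<noteq> \<zero>\<^bsub>R\<^esub>}},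
      monoid.mult = undefined, one = undefined,
      zero = (\<lambda>s. \<zero>\<^bsub>R\<^esub>), add = (\<lambda>f g s. f s \<oplus>\<^bsub>R\<^esub> g s),
      smult = (\<lambda>a f s. a \<otimes>\<^bsub>R\<^esub> f s)\<rparr>"

definition free_gen :: "('k, 'r) ring_scheme \<Rightarrow> 's \<Rightarrow> 's \<Rightarrow> 'k" where
  "free_gen R s = (\<lambda>t. if t = s then \<one>\<^bsub>R\<^esub> else \<zero>\<^bsub>R\<^esub>)"

type_synonym ('k, 'm, 'n) tensor = "('m \<times> 'n \<Rightarrow> 'k) set"

definition free_pairs ::
  "('k, 'r) ring_scheme \<Rightarrow> ('k, 'm, 'a) module_scheme \<Rightarrow> ('k, 'n, 'b) module_scheme
    \<Rightarrow> ('k, 'm \<times> 'n \<Rightarrow> 'k) module"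
where
  "free_pairs R M N = free_module R (carrier M \<times> carrier N)"

definition tensor_rels ::
  "('k, 'r) ring_scheme \<Rightarrow> ('k, 'm, 'a) module_scheme \<Rightarrow> ('k, 'n, 'b) module_scheme
    \<Rightarrow> ('m \<times> 'n \<Rightarrow> 'k) set"
where
  "tensor_rels R M N = (let F = free_pairs R M N; e = (\<lambda>m n. free_gen R (m, n)) in
     {e (m \<oplus>\<^bsub>M\<^esub> m') n \<ominus>\<^bsub>F\<^esub> (e m n \<oplus>\<^bsub>F\<^esub> e m' n) | m m' n.
        m \<in> carrier M \<and> m' \<in> carrier M \<and> n \<in> carrier N} \<union>
     {e m (n \<oplus>\<^bsub>N\<^esub> n') \<ominus>\<^bsub>F\<^esub> (e m n \<oplus>\<^bsub>F\<^esub> e m n') | m n n'.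
        m \<in> carrier M \<and> n \<in> carrier N \<and> n' \<in> carrier N} \<union>
     {e (a \<odot>\<^bsub>M\<^esub> m) n \<ominus>\<^bsub>F\<^esub> (a \<odot>\<^bsub>F\<^esub> e m n) | a m n.
        a \<in> carrier R \<and> m \<in> carrier M \<and> n \<in> carrier N} \<union>
     {e m (a \<odot>\<^bsub>N\<^esub> n) \<ominus>\<^bsub>F\<^esub> (a \<odot>\<^bsub>F\<^esub> e m n) | a m n.
        a \<in> carrier R \<and> m \<in> carrier M \<and> n \<in> carrier N})"

definition tensor_null ::
  "('k, 'r) ring_scheme \<Rightarrow> ('k, 'm, 'a) module_scheme \<Rightarrow> ('k, 'n, 'b) module_scheme
    \<Rightarrow> ('m \<times> 'n \<Rightarrow> 'k) set"
where
  "tensor_null R M N = \<Inter>{K. submodule K R (free_pairs R M N) \<and> tensor_rels R M N \<subseteq> K}"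

definition tens ::
  "('k, 'r) ring_scheme \<Rightarrow> ('k, 'm, 'a) module_scheme \<Rightarrow> ('k, 'n, 'b) module_scheme
    \<Rightarrow> 'm \<Rightarrow> 'n \<Rightarrow> ('k, 'm, 'n) tensor"
where
  "tens R M N m n = tensor_null R M N +>\<^bsub>free_pairs R M N\<^esub> free_gen R (m, n)"

text \<open>
  The linear map out of the tensor product of \<open>M\<close> and \<open>N\<close> into \<open>P\<close> induced by a map
  \<open>b\<close> that is bilinear on the carriers: evaluate a formal sum representing the coset. For bilinear
  \<open>b\<close> the result does not depend on the representative. Expressions in Sweedler notation
  are rendered by applying such a lift to the tensor in question.
\<close>

definition tlift ::
  "('k, 'r) ring_scheme \<Rightarrow> ('k, 'm, 'a) module_scheme \<Rightarrow> ('k, 'n, 'b) module_scheme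
    \<Rightarrow> ('k, 'p, 'c) module_scheme \<Rightarrow> ('m \<Rightarrow> 'n \<Rightarrow> 'p) \<Rightarrow> ('k, 'm, 'n) tensor \<Rightarrow> 'p"
where
  "tlift R M N P b t = (let f = (SOME f. f \<in> t) in
     \<Oplus>\<^bsub>P\<^esub>s\<in>{s. f s \<noteq> \<zero>\<^bsub>R\<^esub>}. f s \<odot>\<^bsub>P\<^esub> b (fst s) (snd s))"

definition tensor_module ::
  "('k, 'r) ring_scheme \<Rightarrow> ('k, 'm, 'a) module_scheme \<Rightarrow> ('k, 'n, 'b) module_scheme
    \<Rightarrow> ('k, ('k, 'm, 'n) tensor) module"
where
  "tensor_module R M N = (let F = free_pairs R M N; K = tensor_null R M N in
     \<lparr>carrier = a_rcosets\<^bsub>F\<^esub> K, monoid.mult = undefined, one = undefined,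
      zero = K, add = (\<lambda>s t. s <+>\<^bsub>F\<^esub> t),
      smult = (\<lambda>a t. \<Union>f\<in>t. K +>\<^bsub>F\<^esub> (a \<odot>\<^bsub>F\<^esub> f))\<rparr>)"

text \<open>
  For algebras \<open>M\<close> and \<open>N\<close> this is the tensor product algebra, with
  \<open>(m \<otimes> n)(m' \<otimes> n') = mm' \<otimes> nn'\<close>.
\<close>

definition tensor ::
  "('k, 'r) ring_scheme \<Rightarrow> ('k, 'm, 'a) module_scheme \<Rightarrow> ('k, 'n, 'b) module_scheme
    \<Rightarrow> ('k, ('k, 'm, 'n) tensor) module"
where
  "tensor R M N = (let T = tensor_module R M N in
     T\<lparr>monoid.mult := (\<lambda>s t. tlift R M N T (\<lambda>m n. tlift R M N T
                  (\<lambda>m' n'. tens R M N (m \<otimes>\<^bsub>M\<^esub> m') (n \<otimes>\<^bsub>N\<^esub> n')) t) s),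
       one := tens R M N \<one>\<^bsub>M\<^esub> \<one>\<^bsub>N\<^esub>\<rparr>)"

definition tens_map ::
  "('k, 'r) ring_scheme \<Rightarrow> ('k, 'm, 'a) module_scheme \<Rightarrow> ('k, 'n, 'b) module_scheme
    \<Rightarrow> ('k, 'p, 'c) module_scheme \<Rightarrow> ('k, 'q, 'd) module_scheme
    \<Rightarrow> ('m \<Rightarrow> 'p) \<Rightarrow> ('n \<Rightarrow> 'q) \<Rightarrow> ('k, 'm, 'n) tensor \<Rightarrow> ('k, 'p, 'q) tensor"
where
  "tens_map R M N P Q f g = tlift R M N (tensor R P Q) (\<lambda>m n. tens R P Q (f m) (g n))"

definition tens_flip ::
  "('k, 'r) ring_scheme \<Rightarrow> ('k, 'm, 'a) module_scheme \<Rightarrow> ('k, 'n, 'b) module_scheme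
    \<Rightarrow> ('k, 'm, 'n) tensor \<Rightarrow> ('k, 'n, 'm) tensor"
where
  "tens_flip R M N = tlift R M N (tensor R N M) (\<lambda>m n. tens R N M n m)"

text \<open>
  Triple tensor products are bracketed to the right; \<open>tens_assoc\<close> is the canonical
  isomorphism from the left bracketing.
\<close>

definition tens_assoc ::
  "('k, 'r) ring_scheme \<Rightarrow> ('k, 'm, 'a) module_scheme \<Rightarrow> ('k, 'n, 'b) module_scheme
    \<Rightarrow> ('k, 'p, 'c) module_scheme
    \<Rightarrow> ('k, ('k, 'm, 'n) tensor, 'p) tensor \<Rightarrow> ('k, 'm, ('k, 'n, 'p) tensor) tensor"
where
  "tens_assoc R M N P = (let T = tensor R M (tensor R N P) in
     tlift R (tensor R M N) P T (\<lambda>t p.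
       tlift R M N T (\<lambda>m n. tens R M (tensor R N P) m (tens R N P n p)) t))"

definition leg13 ::
  "('k, 'r) ring_scheme \<Rightarrow> ('k, 'm, 'a) module_scheme \<Rightarrow> ('k, 'n, 'b) module_scheme
    \<Rightarrow> ('k, 'p, 'c) module_scheme
    \<Rightarrow> ('k, 'm, 'p) tensor \<Rightarrow> ('k, 'm, ('k, 'n, 'p) tensor) tensor"
where
  "leg13 R M N P = tlift R M P (tensor R M (tensor R N P))
     (\<lambda>m p. tens R M (tensor R N P) m (tens R N P \<one>\<^bsub>N\<^esub> p))"


section \<open>Hopf algebras and their duals\<close>

record ('k, 'h) hopf_algebra = "('k, 'h) module" +
  comult :: "'h \<Rightarrow> ('k, 'h, 'h) tensor"
  counit :: "'h \<Rightarrow> 'k"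
  antipode :: "'h \<Rightarrow> 'h"

locale hopf_algebra = field R + unital_algebra R H
  for R :: "('k, 'r) ring_scheme" (structure)
    and H :: "('k, 'h, 'a) hopf_algebra_scheme" (structure) +
  assumes comult_hom: "comult H \<in> alg_hom R H (tensor R H H)"
    and counit_hom: "counit H \<in> alg_hom R H (base_algebra R)"
    and coassoc: "h \<in> carrier H \<Longrightarrow>
        tens_assoc R H H H (tens_map R H H (tensor R H H) H (comult H) (\<lambda>g. g) (comult H h)) =
        tens_map R H H H (tensor R H H) (\<lambda>g. g) (comult H) (comult H h)"
    and counit_left: "h \<in> carrier H \<Longrightarrow>
        tlift R H H H (\<lambda>a b. counit H a \<odot>\<^bsub>H\<^esub> b) (comult H h) = h"
    and counit_right: "h \<in> carrier H \<Longrightarrow>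
        tlift R H H H (\<lambda>a b. counit H b \<odot>\<^bsub>H\<^esub> a) (comult H h) = h"
    and antipode_lin: "antipode H \<in> lin_map R H H"
    and antipode_left: "h \<in> carrier H \<Longrightarrow>
        tlift R H H H (\<lambda>a b. antipode H a \<otimes>\<^bsub>H\<^esub> b) (comult H h) = counit H h \<odot>\<^bsub>H\<^esub> \<one>\<^bsub>H\<^esub>"
    and antipode_right: "h \<in> carrier H \<Longrightarrow>
        tlift R H H H (\<lambda>a b. a \<otimes>\<^bsub>H\<^esub> antipode H b) (comult H h) = counit H h \<odot>\<^bsub>H\<^esub> \<one>\<^bsub>H\<^esub>"
    and antipode_bij: "bij_betw (antipode H) (carrier H) (carrier H)"

text \<open>
  The linear functionals on \<open>H\<close> with the convolution product
  \<open>(\<theta>\<theta>')(h) = \<theta>(h\<^sub>1) \<theta>'(h\<^sub>2)\<close>.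
  The pairing of \<open>h\<close> and \<open>\<theta>\<close> is the application \<open>\<theta> h\<close>.
\<close>

definition dual_algebra ::
  "('k, 'r) ring_scheme \<Rightarrow> ('k, 'h, 'a) hopf_algebra_scheme \<Rightarrow> ('k, 'h \<Rightarrow> 'k) module"
where
  "dual_algebra R H =
     \<lparr>carrier = lin_map R H (base_algebra R) \<inter> extensional (carrier H),
      monoid.mult = (\<lambda>\<theta> \<theta>'. \<lambda>h\<in>carrier H.
         tlift R H H (base_algebra R) (\<lambda>a b. \<theta> a \<otimes>\<^bsub>R\<^esub> \<theta>' b) (comult H h)),
      one = (\<lambda>h\<in>carrier H. counit H h),
      zero = (\<lambda>h\<in>carrier H. \<zero>\<^bsub>R\<^esub>),
      add = (\<lambda>\<theta> \<theta>'. \<lambda>h\<in>carrier H. \<theta> h \<oplus>\<^bsub>R\<^esub> \<theta>' h),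
      smult = (\<lambda>a \<theta>. \<lambda>h\<in>carrier H. a \<otimes>\<^bsub>R\<^esub> \<theta> h)\<rparr>"

text \<open>
  For finite-dimensional \<open>H\<close> the comultiplication of \<open>\<theta>\<close> is the unique tensor
  satisfying \<open>\<theta>(hh') = \<theta>\<^sub>1(h) \<theta>\<^sub>2(h')\<close>.
\<close>

definition dual_comult ::
  "('k, 'r) ring_scheme \<Rightarrow> ('k, 'h, 'a) hopf_algebra_scheme \<Rightarrow> ('h \<Rightarrow> 'k)
    \<Rightarrow> ('k, 'h \<Rightarrow> 'k, 'h \<Rightarrow> 'k) tensor"
where
  "dual_comult R H \<theta> = (let D = dual_algebra R H in
     THE t. t \<in> carrier (tensor R D D) \<and>
       (\<forall>h\<in>carrier H. \<forall>h'\<in>carrier H.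
          tlift R D D (base_algebra R) (\<lambda>\<phi> \<psi>. \<phi> h \<otimes>\<^bsub>R\<^esub> \<psi> h') t = \<theta> (h \<otimes>\<^bsub>H\<^esub> h')))"

definition dual ::
  "('k, 'r) ring_scheme \<Rightarrow> ('k, 'h, 'a) hopf_algebra_scheme \<Rightarrow> ('k, 'h \<Rightarrow> 'k) hopf_algebra"
where
  "dual R H = module.extend (dual_algebra R H)
     \<lparr>comult = dual_comult R H,
      counit = (\<lambda>\<theta>. \<theta> \<one>\<^bsub>H\<^esub>),
      antipode = (\<lambda>\<theta>. \<lambda>h\<in>carrier H. \<theta> (antipode H h))\<rparr>"

definition dual_vec ::
  "('k, 'r) ring_scheme \<Rightarrow> ('k, 'h, 'a) hopf_algebra_scheme \<Rightarrow> 'h set \<Rightarrow> 'h \<Rightarrow> 'h \<Rightarrow> 'k"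
where
  "dual_vec R H B b = (THE \<theta>. \<theta> \<in> carrier (dual R H) \<and>
     (\<forall>b'\<in>B. \<theta> b' = (if b' = b then \<one>\<^bsub>R\<^esub> else \<zero>\<^bsub>R\<^esub>)))"

text \<open>
  The canonical element \<open>U\<close> of \<open>H \<otimes> dual H\<close>; it does not depend on the
  basis chosen.
\<close>

definition canonical_element ::
  "('k, 'r) ring_scheme \<Rightarrow> ('k, 'h, 'a) hopf_algebra_scheme \<Rightarrow> ('k, 'h, 'h \<Rightarrow> 'k) tensor"
where
  "canonical_element R H = (let B = (SOME B. finite_basis R H B) in
     \<Oplus>\<^bsub>tensor R H (dual R H)\<^esub>b\<in>B. tens R H (dual R H) b (dual_vec R H B b))"


section \<open>Coactions, actions and Yetter--Drinfeld algebras\<close>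

definition left_coaction ::
  "('k, 'r) ring_scheme \<Rightarrow> ('k, 'g, 'a) hopf_algebra_scheme \<Rightarrow> ('k, 'x, 'b) module_scheme
    \<Rightarrow> ('x \<Rightarrow> ('k, 'g, 'x) tensor) \<Rightarrow> bool"
where
  "left_coaction R K X \<beta> \<longleftrightarrow>
     \<beta> \<in> alg_hom R X (tensor R K X) \<and>
     (\<forall>x\<in>carrier X.
        tens_map R K X K (tensor R K X) (\<lambda>g. g) \<beta> (\<beta> x) =
        tens_assoc R K K X (tens_map R K X (tensor R K K) X (comult K) (\<lambda>y. y) (\<beta> x))) \<and>
     (\<forall>x\<in>carrier X. tlift R K X X (\<lambda>g y. counit K g \<odot>\<^bsub>X\<^esub> y) (\<beta> x) = x)"

definition right_coaction ::
  "('k, 'r) ring_scheme \<Rightarrow> ('k, 'h, 'a) hopf_algebra_scheme \<Rightarrow> ('k, 'x, 'b) module_scheme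
    \<Rightarrow> ('x \<Rightarrow> ('k, 'x, 'h) tensor) \<Rightarrow> bool"
where
  "right_coaction R H X \<alpha> \<longleftrightarrow>
     \<alpha> \<in> alg_hom R X (tensor R X H) \<and>
     (\<forall>x\<in>carrier X.
        tens_assoc R X H H (tens_map R X H (tensor R X H) H \<alpha> (\<lambda>h. h) (\<alpha> x)) =
        tens_map R X H X (tensor R H H) (\<lambda>y. y) (comult H) (\<alpha> x)) \<and>
     (\<forall>x\<in>carrier X. tlift R X H X (\<lambda>y h. counit H h \<odot>\<^bsub>X\<^esub> y) (\<alpha> x) = x)"

definition right_action ::
  "('k, 'r) ring_scheme \<Rightarrow> ('k, 'h, 'a) hopf_algebra_scheme \<Rightarrow> ('k, 'x, 'b) module_scheme
    \<Rightarrow> ('x \<Rightarrow> 'h \<Rightarrow> 'x) \<Rightarrow> bool"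
where
  "right_action R H X act \<longleftrightarrow>
     (\<forall>h\<in>carrier H. (\<lambda>x. act x h) \<in> lin_map R X X) \<and>
     (\<forall>x\<in>carrier X. act x \<in> lin_map R H X) \<and>
     (\<forall>x\<in>carrier X. act x \<one>\<^bsub>H\<^esub> = x) \<and>
     (\<forall>x\<in>carrier X. \<forall>g\<in>carrier H. \<forall>h\<in>carrier H. act x (g \<otimes>\<^bsub>H\<^esub> h) = act (act x g) h) \<and>
     (\<forall>x\<in>carrier X. \<forall>y\<in>carrier X. \<forall>h\<in>carrier H.
        act (x \<otimes>\<^bsub>X\<^esub> y) h = tlift R H H X (\<lambda>a b. act x a \<otimes>\<^bsub>X\<^esub> act y b) (comult H h)) \<and>
     (\<forall>h\<in>carrier H. act \<one>\<^bsub>X\<^esub> h = counit H h \<odot>\<^bsub>X\<^esub> \<one>\<^bsub>X\<^esub>)"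

definition Ad :: "('a, 'b) monoid_scheme \<Rightarrow> 'a \<Rightarrow> 'a \<Rightarrow> 'a" where
  "Ad G w z = w \<otimes>\<^bsub>G\<^esub> z \<otimes>\<^bsub>G\<^esub> inv\<^bsub>G\<^esub> w"

definition right_left_YD_algebra ::
  "('k, 'r) ring_scheme \<Rightarrow> ('k, 'h, 'a) hopf_algebra_scheme \<Rightarrow> ('k, 'x, 'b) module_scheme
    \<Rightarrow> ('x \<Rightarrow> ('k, 'x, 'h) tensor) \<Rightarrow> ('x \<Rightarrow> ('k, 'h \<Rightarrow> 'k, 'x) tensor) \<Rightarrow> bool"
where
  "right_left_YD_algebra R H X \<alpha> \<beta> \<longleftrightarrow>
     right_coaction R H X \<alpha> \<and> left_coaction R (dual R H) X \<beta> \<and>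
     (let D = dual R H;
          V = tens_flip R H D (canonical_element R H);
          W = leg13 R D X H (inv\<^bsub>tensor R D H\<^esub> V)
      in \<forall>x\<in>carrier X.
        tens_map R D X D (tensor R X H) (\<lambda>\<theta>. \<theta>) \<alpha> (\<beta> x) =
        Ad (tensor R D (tensor R X H)) W
          (tens_assoc R D X H (tens_map R X H (tensor R D X) H \<beta> (\<lambda>h. h) (\<alpha> x))))"

definition YD_algebra ::
  "('k, 'r) ring_scheme \<Rightarrow> ('k, 'h, 'a) hopf_algebra_scheme \<Rightarrow> ('k, 'x, 'b) module_scheme
    \<Rightarrow> ('x \<Rightarrow> 'h \<Rightarrow> 'x) \<Rightarrow> ('x \<Rightarrow> ('k, 'x, 'h) tensor) \<Rightarrow> bool"
where
  "YD_algebra R H X act \<delta> \<longleftrightarrow>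
     right_action R H X act \<and> right_coaction R H X \<delta> \<and>
     (\<forall>h\<in>carrier H. \<forall>x\<in>carrier X.
        tlift R H H (tensor R X H) (\<lambda>h1 h2.
          tlift R X H (tensor R X H) (\<lambda>x0 x1. tens R X H (act x0 h1) (x1 \<otimes>\<^bsub>H\<^esub> h2)) (\<delta> x))
          (comult H h) =
        tlift R H H (tensor R X H) (\<lambda>h1 h2.
          tlift R X H (tensor R X H) (\<lambda>y0 y1. tens R X H y0 (h1 \<otimes>\<^bsub>H\<^esub> y1)) (\<delta> (act x h2)))
          (comult H h))"

definition induced_action ::
  "('k, 'r) ring_scheme \<Rightarrow> ('k, 'h, 'a) hopf_algebra_scheme \<Rightarrow> ('k, 'x, 'b) module_scheme
    \<Rightarrow> ('x \<Rightarrow> ('k, 'h \<Rightarrow> 'k, 'x) tensor) \<Rightarrow> 'x \<Rightarrow> 'h \<Rightarrow> 'x"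
where
  "induced_action R H X \<beta> x h = tlift R (dual R H) X X (\<lambda>\<theta> y. \<theta> h \<odot>\<^bsub>X\<^esub> y) (\<beta> x)"

end

theory Submission
  imports Defs
begin

text \<open>
  Pairing \<open>h\<close> with the first leg turns a tensor \<open>t\<close> in \<open>D \<otimes> N\<close>, where \<open>D\<close> is the dual of \<open>H\<close>, into
  a linear map from \<open>H\<close> to \<open>N\<close> (\<open>pairing\<close>). Since \<open>H\<close> is finite-dimensional, \<open>t\<close> is recovered
  from this map by means of dual bases (\<open>pairing_ext\<close>), so every identity in \<open>D \<otimes> N\<close> can be
  tested by pairing. For an algebra \<open>N\<close> the product of \<open>D \<otimes> N\<close> becomes the convolution
  \<open>h \<mapsto> f(h\<^sub>1) g(h\<^sub>2)\<close> (\<open>pairing_mult\<close>), the flipped canonical element \<open>V = \<Sigma>(U)\<close> becomes the identity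
  of \<open>H\<close> (\<open>pairing_V\<close>), its inverse the antipode (\<open>pairing_Vinv\<close>), and the coaction \<open>\<beta>(x)\<close> becomes
  \<open>h \<mapsto> x \<lhd> h\<close>. Under this dictionary the axioms of a left coaction of \<open>D\<close> are those of a right
  action of \<open>H\<close> (\<open>induced_action_right_action\<close>).
  
  With \<open>L = (id \<otimes> \<alpha>)(\<beta>(x))\<close> and \<open>M = (\<beta> \<otimes> id)(\<alpha>(x))\<close>, the right-left Yetter--Drinfeld condition
  \<open>L = V\<^sub>1\<^sub>3\<inverse> M V\<^sub>1\<^sub>3\<close> says that \<open>V\<^sub>1\<^sub>3 L = M V\<^sub>1\<^sub>3\<close> (\<open>eq_Ad_W_iff\<close>). Paired with \<open>h\<close>, the left-hand side is
  \<open>(1 \<otimes> h\<^sub>1) \<alpha>(x \<lhd> h\<^sub>2)\<close> (\<open>pairing_Winv_lhs\<close>) and the right-hand side is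
  \<open>(x\<^sub>0 \<lhd> h\<^sub>1) \<otimes> x\<^sub>1 h\<^sub>2\<close> (\<open>pairing_rhs_Winv\<close>), which are the two sides of the right-right condition.
  
  The preliminaries supply what this computation uses of tensor products: the universal property
  (\<open>tlift_lin\<close>, \<open>tlift_tens\<close>), the principle that linear maps agreeing on elementary tensors
  are equal (\<open>tensor_eqI\<close>), and the fact that tensor products of unital algebras are unital
  algebras. They are applied to iterated tensor products, and to \<open>D\<close>, whose associativity is
  the coassociativity of \<open>H\<close>.
\<close>

section \<open>Linear and bilinear maps\<close>

lemma lin_mapI:
  assumes "\<And>x. x \<in> carrier M \<Longrightarrow> f x \<in> carrier N"
    and "\<And>x y. \<lbrakk>x \<in> carrier M; y \<in> carrier M\<rbrakk> \<Longrightarrow> f (x \<oplus>\<^bsub>M\<^esub> y) = f x \<oplus>\<^bsub>N\<^esub> f y"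
    and "\<And>a x. \<lbrakk>a \<in> carrier R; x \<in> carrier M\<rbrakk> \<Longrightarrow> f (a \<odot>\<^bsub>M\<^esub> x) = a \<odot>\<^bsub>N\<^esub> f x"
  shows "f \<in> lin_map R M N"
  using assms by (auto simp: lin_map_def)

lemma lin_map_closed: "\<lbrakk>f \<in> lin_map R M N; x \<in> carrier M\<rbrakk> \<Longrightarrow> f x \<in> carrier N"
  and lin_map_add: "\<lbrakk>f \<in> lin_map R M N; x \<in> carrier M; y \<in> carrier M\<rbrakk> \<Longrightarrow>
    f (x \<oplus>\<^bsub>M\<^esub> y) = f x \<oplus>\<^bsub>N\<^esub> f y"
  and lin_map_smult: "\<lbrakk>f \<in> lin_map R M N; a \<in> carrier R; x \<in> carrier M\<rbrakk> \<Longrightarrow>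
    f (a \<odot>\<^bsub>M\<^esub> x) = a \<odot>\<^bsub>N\<^esub> f x"
  by (auto simp: lin_map_def)

lemma lin_map_zero:
  assumes "module R M" "module R N" "f \<in> lin_map R M N"
  shows "f \<zero>\<^bsub>M\<^esub> = \<zero>\<^bsub>N\<^esub>"
proof -
  interpret M: module R M by fact
  interpret N: module R N by fact
  have "f (\<zero>\<^bsub>R\<^esub> \<odot>\<^bsub>M\<^esub> \<zero>\<^bsub>M\<^esub>) = \<zero>\<^bsub>R\<^esub> \<odot>\<^bsub>N\<^esub> f \<zero>\<^bsub>M\<^esub>"
    using assms(3) by (rule lin_map_smult) auto
  then show ?thesis
    using lin_map_closed[OF assms(3) M.zero_closed] by simp
qed

lemma lin_map_finsum:
  assumes "module R M" "module R N" "f \<in> lin_map R M N" "finite A" "g \<in> A \<rightarrow> carrier M"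
  shows "f (\<Oplus>\<^bsub>M\<^esub>a\<in>A. g a) = (\<Oplus>\<^bsub>N\<^esub>a\<in>A. f (g a))"
proof -
  interpret M: module R M by fact
  interpret N: module R N by fact
  show ?thesis
    using assms(4,5)
  proof (induction A rule: finite_induct)
    case empty
    then show ?case using lin_map_zero[OF assms(1-3)] by simp
  next
    case (insert x F)
    then have g: "g x \<in> carrier M" "g \<in> F \<rightarrow> carrier M" by auto
    have fg: "f (g x) \<in> carrier N" "(\<lambda>a. f (g a)) \<in> F \<rightarrow> carrier N"
      using g lin_map_closed[OF assms(3)] by auto
    have "f (\<Oplus>\<^bsub>M\<^esub>a\<in>insert x F. g a) = f (g x \<oplus>\<^bsub>M\<^esub> (\<Oplus>\<^bsub>M\<^esub>a\<in>F. g a))"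
      using insert.hyps g by simp
    also have "\<dots> = f (g x) \<oplus>\<^bsub>N\<^esub> f (\<Oplus>\<^bsub>M\<^esub>a\<in>F. g a)"
      using g by (intro lin_map_add[OF assms(3)]) auto
    finally show ?case
      using insert.hyps insert.IH g fg by simp
  qed
qed

lemma lin_map_id: "(\<lambda>x. x) \<in> lin_map R M M"
  by (rule lin_mapI) auto

lemma lin_map_comp:
  "\<lbrakk>f \<in> lin_map R M N; g \<in> lin_map R N P\<rbrakk> \<Longrightarrow> (\<lambda>x. g (f x)) \<in> lin_map R M P"
  by (auto simp: lin_map_def Pi_iff)

lemma lin_map_cong:
  assumes "module R M" "f \<in> lin_map R M N" "\<And>x. x \<in> carrier M \<Longrightarrow> g x = f x"
  shows "g \<in> lin_map R M N"
proof -
  interpret module R M by fact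
  show ?thesis using assms(2,3) by (auto simp: lin_map_def Pi_iff)
qed

definition bilin ::
  "('k, 'r) ring_scheme \<Rightarrow> ('k, 'm, 'a) module_scheme \<Rightarrow> ('k, 'n, 'b) module_scheme
    \<Rightarrow> ('k, 'p, 'c) module_scheme \<Rightarrow> ('m \<Rightarrow> 'n \<Rightarrow> 'p) set"
where
  "bilin R M N P = {b. (\<forall>m\<in>carrier M. b m \<in> lin_map R N P) \<and>
     (\<forall>n\<in>carrier N. (\<lambda>m. b m n) \<in> lin_map R M P)}"

lemma bilinI:
  assumes "\<And>m. m \<in> carrier M \<Longrightarrow> (\<lambda>n. b m n) \<in> lin_map R N P"
    and "\<And>n. n \<in> carrier N \<Longrightarrow> (\<lambda>m. b m n) \<in> lin_map R M P"
  shows "b \<in> bilin R M N P"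
  using assms by (auto simp: bilin_def)

lemma bilin_left: "\<lbrakk>b \<in> bilin R M N P; n \<in> carrier N\<rbrakk> \<Longrightarrow> (\<lambda>m. b m n) \<in> lin_map R M P"
  and bilin_right: "\<lbrakk>b \<in> bilin R M N P; m \<in> carrier M\<rbrakk> \<Longrightarrow> (\<lambda>n. b m n) \<in> lin_map R N P"
  and bilin_closed: "\<lbrakk>b \<in> bilin R M N P; m \<in> carrier M; n \<in> carrier N\<rbrakk> \<Longrightarrow> b m n \<in> carrier P"
  by (auto simp: bilin_def lin_map_closed)

lemma bilin_comp:
  "\<lbrakk>b \<in> bilin R M N P; f \<in> lin_map R P Q\<rbrakk> \<Longrightarrow> (\<lambda>m n. f (b m n)) \<in> bilin R M N Q"
  by (intro bilinI) (auto intro: lin_map_comp bilin_left bilin_right)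


section \<open>The free module on a set\<close>

lemma free_module_simps:
  "f \<in> carrier (free_module R S) \<longleftrightarrow>
     (\<forall>s\<in>S. f s \<in> carrier R) \<and> (\<forall>s. s \<notin> S \<longrightarrow> f s = \<zero>\<^bsub>R\<^esub>) \<and> finite {s. f s \<noteq> \<zero>\<^bsub>R\<^esub>}"
  "\<zero>\<^bsub>free_module R S\<^esub> = (\<lambda>s. \<zero>\<^bsub>R\<^esub>)"
  "f \<oplus>\<^bsub>free_module R S\<^esub> g = (\<lambda>s. f s \<oplus>\<^bsub>R\<^esub> g s)"
  "a \<odot>\<^bsub>free_module R S\<^esub> f = (\<lambda>s. a \<otimes>\<^bsub>R\<^esub> f s)"
  by (simp_all add: free_module_def)

lemma (in cring) free_module_val: "f \<in> carrier (free_module R S) \<Longrightarrow> f s \<in> carrier R"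
  by (cases "s \<in> S") (auto simp: free_module_simps)

lemma (in cring) free_module_module: "module R (free_module R S)"
proof (rule moduleI)
  let ?F = "free_module R S"
  note val = free_module_val[of _ S]
  have add: "f \<oplus>\<^bsub>?F\<^esub> g \<in> carrier ?F" if "f \<in> carrier ?F" "g \<in> carrier ?F" for f g
  proof -
    have "{s. f s \<oplus> g s \<noteq> \<zero>} \<subseteq> {s. f s \<noteq> \<zero>} \<union> {s. g s \<noteq> \<zero>}" by auto
    then show ?thesis
      using that by (auto simp: free_module_simps intro: finite_subset)
  qed
  have neg: "(\<lambda>s. \<ominus> f s) \<in> carrier ?F" if f: "f \<in> carrier ?F" for f
  proof -
    have "{s. \<ominus> f s \<noteq> \<zero>} \<subseteq> {s. f s \<noteq> \<zero>}" by auto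
    then show ?thesis
      using that by (auto simp: free_module_simps intro: finite_subset)
  qed
  show "cring R" ..
  show "abelian_group ?F"
  proof (rule abelian_groupI)
    show "\<exists>g\<in>carrier ?F. g \<oplus>\<^bsub>?F\<^esub> f = \<zero>\<^bsub>?F\<^esub>" if "f \<in> carrier ?F" for f
      using neg[OF that] val[OF that] by (intro bexI[of _ "\<lambda>s. \<ominus> f s"]) (auto simp: free_module_simps(2-) l_neg)
    show "\<zero>\<^bsub>?F\<^esub> \<in> carrier ?F" by (simp add: free_module_simps)
  qed (use add val in \<open>auto simp: free_module_simps(2-) a_ac\<close>)
  show "a \<odot>\<^bsub>?F\<^esub> f \<in> carrier ?F" if "a \<in> carrier R" "f \<in> carrier ?F" for a f
  proof -
    have "{s. a \<otimes> f s \<noteq> \<zero>} \<subseteq> {s. f s \<noteq> \<zero>}" using that(1) by auto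
    then show ?thesis
      using that by (auto simp: free_module_simps intro: finite_subset)
  qed
qed (use free_module_val[of _ S] in \<open>auto simp: free_module_simps(2-) l_distr r_distr m_assoc\<close>)

lemma (in cring) free_gen_closed: "s \<in> S \<Longrightarrow> free_gen R s \<in> carrier (free_module R S)"
proof -
  have "{t. free_gen R s t \<noteq> \<zero>} \<subseteq> {s}" by (auto simp: free_gen_def)
  then show "s \<in> S \<Longrightarrow> ?thesis"
    by (auto simp: free_module_simps free_gen_def)
qed

lemma (in cring) free_module_induct [consumes 1, case_names zero step]:
  assumes f: "f \<in> carrier (free_module R S)"
    and zero: "Q (\<lambda>s. \<zero>)"
    and step: "\<And>a s f. \<lbrakk>a \<in> carrier R; s \<in> S; f \<in> carrier (free_module R S); Q f\<rbrakk> \<Longrightarrow>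
      Q (a \<odot>\<^bsub>free_module R S\<^esub> free_gen R s \<oplus>\<^bsub>free_module R S\<^esub> f)"
  shows "Q f"
proof -
  have "Q f" if "finite A" "f \<in> carrier (free_module R S)" "{s. f s \<noteq> \<zero>} \<subseteq> A" for A f
    using that
  proof (induction A arbitrary: f rule: finite_induct)
    case empty
    then have "f = (\<lambda>s. \<zero>)" by auto
    then show ?case using zero by simp
  next
    case (insert s A)
    show ?case
    proof (cases "f s = \<zero>")
      case True
      then show ?thesis using insert by (intro insert.IH) auto
    next
      case False
      define g where "g = f(s := \<zero>)"
      have s: "s \<in> S" using False insert.prems(1) by (auto simp: free_module_simps)
      have "{t. g t \<noteq> \<zero>} \<subseteq> {t. f t \<noteq> \<zero>}" by (auto simp: g_def)
      then have g: "g \<in> carrier (free_module R S)"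
        using insert.prems(1) by (auto simp: free_module_simps g_def intro: finite_subset)
      have "Q g"
        by (rule insert.IH[OF g]) (use insert.prems(2) in \<open>auto simp: g_def split: if_splits\<close>)
      moreover have "f = f s \<odot>\<^bsub>free_module R S\<^esub> free_gen R s \<oplus>\<^bsub>free_module R S\<^esub> g"
        using free_module_val[OF insert.prems(1)]
        by (auto simp: fun_eq_iff free_module_simps(2-) free_gen_def g_def)
      ultimately show ?thesis
        using step[of "f s" s g] s g free_module_val[OF insert.prems(1)] by simp
    qed
  qed
  then show ?thesis using f by (auto simp: free_module_simps)
qed

text \<open>
  The linear extension of \<open>b\<close> from the generators, written with the same sum as \<open>tlift\<close>, so that
  lifting a bilinear map to the tensor product is linear extension applied to a representative.
\<close>

definition lin_ext :: "('k, 'r) ring_scheme \<Rightarrow> ('k, 'p, 'c) module_scheme \<Rightarrow> ('s \<Rightarrow> 'p)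
    \<Rightarrow> ('s \<Rightarrow> 'k) \<Rightarrow> 'p" where
  "lin_ext R P b f = (\<Oplus>\<^bsub>P\<^esub>s\<in>{s. f s \<noteq> \<zero>\<^bsub>R\<^esub>}. f s \<odot>\<^bsub>P\<^esub> b s)"

text \<open>
  The support varies with \<open>f\<close>; summing over a common finite superset is what makes additivity
  a statement about sums over one index set.
\<close>

lemma lin_ext_superset:
  assumes "module R P" "b \<in> S \<rightarrow> carrier P" "f \<in> carrier (free_module R S)"
    and "finite A" "{s. f s \<noteq> \<zero>\<^bsub>R\<^esub>} \<subseteq> A" "A \<subseteq> S"
  shows "lin_ext R P b f = (\<Oplus>\<^bsub>P\<^esub>s\<in>A. f s \<odot>\<^bsub>P\<^esub> b s)"
proof -
  interpret P: module R P by fact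
  show ?thesis unfolding lin_ext_def
  proof (rule P.add.finprod_mono_neutral_cong_left[OF assms(4,5)])
    show "f i \<odot>\<^bsub>P\<^esub> b i = \<zero>\<^bsub>P\<^esub>" if "i \<in> A - {s. f s \<noteq> \<zero>\<^bsub>R\<^esub>}" for i
      using that assms(2,6) by (auto intro: P.smult_l_null)
    show "(\<lambda>s. f s \<odot>\<^bsub>P\<^esub> b s) \<in> A \<rightarrow> carrier P"
      using assms(2,3,6) by (auto simp: free_module_simps)
  qed simp
qed

lemma lin_ext_lin:
  assumes P: "module R P" and b: "b \<in> S \<rightarrow> carrier P"
  shows "lin_ext R P b \<in> lin_map R (free_module R S) P"
proof (rule lin_mapI)
  interpret P: module R P by fact
  interpret F: module R "free_module R S" by (rule P.free_module_module)
  let ?supp = "\<lambda>f. {s. f s \<noteq> \<zero>\<^bsub>R\<^esub>}"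
  note ext = lin_ext_superset[OF P b]
  have supp: "finite (?supp f)" "?supp f \<subseteq> S" if "f \<in> carrier (free_module R S)" for f
    using that by (auto simp: free_module_simps)
  have cl: "(\<lambda>s. f s \<odot>\<^bsub>P\<^esub> b s) \<in> A \<rightarrow> carrier P"
    if "f \<in> carrier (free_module R S)" "A \<subseteq> S" for f A
    using that b by (auto simp: free_module_simps)
  show "lin_ext R P b f \<in> carrier P" if "f \<in> carrier (free_module R S)" for f
    unfolding lin_ext_def using cl[OF that supp(2)[OF that]] by simp
  fix f g a assume f: "f \<in> carrier (free_module R S)"
  { assume g: "g \<in> carrier (free_module R S)"
    define A where "A = ?supp f \<union> ?supp g"
    have A: "finite A" "A \<subseteq> S" using supp[OF f] supp[OF g] by (auto simp: A_def)
    have "lin_ext R P b (f \<oplus>\<^bsub>free_module R S\<^esub> g) =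
        (\<Oplus>\<^bsub>P\<^esub>s\<in>A. (f \<oplus>\<^bsub>free_module R S\<^esub> g) s \<odot>\<^bsub>P\<^esub> b s)"
      using f g A by (intro ext F.a_closed) (auto simp: A_def free_module_simps(2-))
    also have "\<dots> = (\<Oplus>\<^bsub>P\<^esub>s\<in>A. f s \<odot>\<^bsub>P\<^esub> b s \<oplus>\<^bsub>P\<^esub> g s \<odot>\<^bsub>P\<^esub> b s)"
      using f g A b by (intro P.finsum_cong refl)
        (auto simp: free_module_simps simp_implies_def P.smult_l_distr Pi_iff subset_iff)
    also have "\<dots> = (\<Oplus>\<^bsub>P\<^esub>s\<in>A. f s \<odot>\<^bsub>P\<^esub> b s) \<oplus>\<^bsub>P\<^esub> (\<Oplus>\<^bsub>P\<^esub>s\<in>A. g s \<odot>\<^bsub>P\<^esub> b s)"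
      by (intro P.finsum_addf cl f g A)
    also have "\<dots> = lin_ext R P b f \<oplus>\<^bsub>P\<^esub> lin_ext R P b g"
      using ext[OF f A(1) _ A(2)] ext[OF g A(1) _ A(2)] by (simp add: A_def)
    finally show "lin_ext R P b (f \<oplus>\<^bsub>free_module R S\<^esub> g) = lin_ext R P b f \<oplus>\<^bsub>P\<^esub> lin_ext R P b g" .
  }
  assume a: "a \<in> carrier R"
  have "lin_ext R P b (a \<odot>\<^bsub>free_module R S\<^esub> f) =
      (\<Oplus>\<^bsub>P\<^esub>s\<in>?supp f. (a \<odot>\<^bsub>free_module R S\<^esub> f) s \<odot>\<^bsub>P\<^esub> b s)"
    using a f supp[OF f] by (intro ext F.smult_closed) (auto simp: free_module_simps(2-))
  also have "\<dots> = (\<Oplus>\<^bsub>P\<^esub>s\<in>?supp f. a \<odot>\<^bsub>P\<^esub> (f s \<odot>\<^bsub>P\<^esub> b s))"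
    using a f b supp(2)[OF f] by (intro P.finsum_cong refl)
      (auto simp: free_module_simps simp_implies_def P.smult_assoc1 Pi_iff subset_iff)
  also have "\<dots> = a \<odot>\<^bsub>P\<^esub> lin_ext R P b f"
    unfolding lin_ext_def
    by (rule P.finsum_smult_ldistr[symmetric]) (use a supp[OF f] cl[OF f] in auto)
  finally show "lin_ext R P b (a \<odot>\<^bsub>free_module R S\<^esub> f) = a \<odot>\<^bsub>P\<^esub> lin_ext R P b f" .
qed

lemma lin_ext_gen:
  assumes P: "module R P" and b: "b \<in> S \<rightarrow> carrier P" and s: "s \<in> S"
  shows "lin_ext R P b (free_gen R s) = b s"
proof -
  interpret P: module R P by fact
  have bs: "b s \<in> carrier P" using b s by auto
  have "lin_ext R P b (free_gen R s) = (\<Oplus>\<^bsub>P\<^esub>t\<in>{s}. free_gen R s t \<odot>\<^bsub>P\<^esub> b t)"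
    using s by (intro lin_ext_superset[OF P b] P.free_gen_closed) (auto simp: free_gen_def)
  then show ?thesis using bs by (simp add: free_gen_def)
qed


section \<open>The tensor product of modules\<close>

lemma tensor_simps:
  "carrier (tensor R M N) = a_rcosets\<^bsub>free_pairs R M N\<^esub> (tensor_null R M N)"
  "\<zero>\<^bsub>tensor R M N\<^esub> = tensor_null R M N"
  "s \<oplus>\<^bsub>tensor R M N\<^esub> t = s <+>\<^bsub>free_pairs R M N\<^esub> t"
  "a \<odot>\<^bsub>tensor R M N\<^esub> t =
     (\<Union>f\<in>t. tensor_null R M N +>\<^bsub>free_pairs R M N\<^esub> (a \<odot>\<^bsub>free_pairs R M N\<^esub> f))"
  "s \<otimes>\<^bsub>tensor R M N\<^esub> t = tlift R M N (tensor_module R M N) (\<lambda>m n.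
     tlift R M N (tensor_module R M N) (\<lambda>m' n'. tens R M N (m \<otimes>\<^bsub>M\<^esub> m') (n \<otimes>\<^bsub>N\<^esub> n')) t) s"
  "\<one>\<^bsub>tensor R M N\<^esub> = tens R M N \<one>\<^bsub>M\<^esub> \<one>\<^bsub>N\<^esub>"
  by (simp_all add: tensor_def tensor_module_def Let_def)

text \<open>
  The carrier of the tensor product consists of the cosets \<open>cls f\<close> of formal sums \<open>f\<close> modulo \<open>K\<close>;
  all operations on cosets are reduced to operations on representatives.
\<close>

locale tensor_product = M: module R M + N: module R N
  for R :: "('k, 'r) ring_scheme" and M :: "('k, 'm, 'a) module_scheme"
    and N :: "('k, 'n, 'b) module_scheme"
begin

abbreviation "F \<equiv> free_pairs R M N"
abbreviation "K \<equiv> tensor_null R M N"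
abbreviation "gen m n \<equiv> free_gen R (m, n)"
abbreviation cls where "cls f \<equiv> K +>\<^bsub>F\<^esub> f"

sublocale F: module R F
  unfolding free_pairs_def by (rule M.free_module_module)

lemma gen_closed: "\<lbrakk>m \<in> carrier M; n \<in> carrier N\<rbrakk> \<Longrightarrow> gen m n \<in> carrier F"
  unfolding free_pairs_def by (rule M.free_gen_closed) auto

lemma rels_closed: "tensor_rels R M N \<subseteq> carrier F"
  unfolding tensor_rels_def Let_def
  by (auto intro!: F.minus_closed F.a_closed F.smult_closed gen_closed
      M.a_closed N.a_closed M.smult_closed N.smult_closed)

lemma null_least: "\<lbrakk>submodule L R F; tensor_rels R M N \<subseteq> L\<rbrakk> \<Longrightarrow> K \<subseteq> L"
  by (auto simp: tensor_null_def)

lemma null_rels: "tensor_rels R M N \<subseteq> K"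
  by (auto simp: tensor_null_def)

lemma null_submodule: "submodule K R F"
proof (rule F.submoduleI)
  show "K \<subseteq> carrier F" by (rule null_least[OF F.carrier_is_submodule rels_closed])
  show "\<zero>\<^bsub>F\<^esub> \<in> K"
    using subgroup.one_closed[OF submodule.axioms(1)] by (force simp: tensor_null_def)
qed (use F.submoduleE in \<open>auto simp: tensor_null_def\<close>)

sublocale K: abelian_subgroup K F
proof (rule abelian_subgroupI3)
  show "additive_subgroup K F"
    using submodule.axioms(1)[OF null_submodule] by (rule additive_subgroup.intro)
qed (rule F.abelian_group_axioms)

lemma cls_closed: "f \<in> carrier F \<Longrightarrow> cls f \<in> carrier (tensor R M N)"
  unfolding tensor_simps by (rule F.a_rcosetsI[OF K.a_subset])

lemma cls_cases:
  assumes "t \<in> carrier (tensor R M N)"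
  obtains f where "f \<in> carrier F" "t = cls f"
  using assms unfolding tensor_simps A_RCOSETS_def' by blast

lemma cls_add: "\<lbrakk>f \<in> carrier F; g \<in> carrier F\<rbrakk> \<Longrightarrow>
    cls f \<oplus>\<^bsub>tensor R M N\<^esub> cls g = cls (f \<oplus>\<^bsub>F\<^esub> g)"
  unfolding tensor_simps by (rule K.a_rcos_sum)

lemma cls_zero: "cls \<zero>\<^bsub>F\<^esub> = \<zero>\<^bsub>tensor R M N\<^esub>"
  unfolding tensor_simps by (rule F.a_coset_add_zero[OF K.a_subset])

lemma cls_eq_iff:
  assumes "f \<in> carrier F" "g \<in> carrier F"
  shows "cls f = cls g \<longleftrightarrow> f \<ominus>\<^bsub>F\<^esub> g \<in> K"
proof -
  have "cls f = cls g \<longleftrightarrow> f \<in> cls g"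
    using K.a_repr_independence'[of f g] K.a_rcos_self[of f] assms by auto
  then show ?thesis
    using K.a_rcos_module[OF assms(2,1)] by (simp only: F.minus_eq)
qed

lemma cls_smult:
  assumes a: "a \<in> carrier R" and f: "f \<in> carrier F"
  shows "a \<odot>\<^bsub>tensor R M N\<^esub> cls f = cls (a \<odot>\<^bsub>F\<^esub> f)"
proof -
  have "cls (a \<odot>\<^bsub>F\<^esub> g) = cls (a \<odot>\<^bsub>F\<^esub> f)" if g: "g \<in> cls f" for g
  proof -
    have gF: "g \<in> carrier F" using K.a_elemrcos_carrier[OF f g] .
    have "g \<ominus>\<^bsub>F\<^esub> f \<in> K" using K.a_rcos_module[OF f gF] g by (simp add: F.minus_eq)
    then have "a \<odot>\<^bsub>F\<^esub> (g \<ominus>\<^bsub>F\<^esub> f) \<in> K" using F.submoduleE(4)[OF null_submodule a] by blast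
    moreover have "a \<odot>\<^bsub>F\<^esub> (g \<ominus>\<^bsub>F\<^esub> f) = a \<odot>\<^bsub>F\<^esub> g \<ominus>\<^bsub>F\<^esub> a \<odot>\<^bsub>F\<^esub> f"
      using a f gF by (simp add: F.minus_eq F.smult_r_distr F.smult_r_minus)
    ultimately show ?thesis
      using cls_eq_iff[of "a \<odot>\<^bsub>F\<^esub> g" "a \<odot>\<^bsub>F\<^esub> f"] a f gF by simp
  qed
  moreover have "cls f \<noteq> {}" using K.a_rcos_self[OF f] by auto
  ultimately show ?thesis unfolding tensor_simps by auto
qed

lemma module_tensor: "module R (tensor R M N)"
proof (rule moduleI)
  show "cring R" by (rule M.R.cring_axioms)
  show "abelian_group (tensor R M N)"
  proof (rule abelian_groupI)
    show "\<exists>s\<in>carrier (tensor R M N). s \<oplus>\<^bsub>tensor R M N\<^esub> t = \<zero>\<^bsub>tensor R M N\<^esub>"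
      if "t \<in> carrier (tensor R M N)" for t
    proof -
      obtain f where f: "f \<in> carrier F" "t = cls f" using \<open>t \<in> _\<close> by (rule cls_cases)
      then have "cls (\<ominus>\<^bsub>F\<^esub> f) \<oplus>\<^bsub>tensor R M N\<^esub> t = \<zero>\<^bsub>tensor R M N\<^esub>"
        by (simp add: cls_add F.l_neg cls_zero)
      then show ?thesis using f cls_closed[of "\<ominus>\<^bsub>F\<^esub> f"] by blast
    qed
  qed (auto elim!: cls_cases simp: cls_add cls_closed F.a_ac simp flip: cls_zero)
qed (auto elim!: cls_cases simp: cls_smult cls_add cls_closed
    F.smult_l_distr F.smult_r_distr F.smult_assoc1)

lemma tens_cls: "tens R M N m n = cls (gen m n)"
  by (simp add: tens_def)

lemma tens_closed: "\<lbrakk>m \<in> carrier M; n \<in> carrier N\<rbrakk> \<Longrightarrow> tens R M N m n \<in> carrier (tensor R M N)"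
  unfolding tens_cls by (intro cls_closed gen_closed)

lemma tens_bilin: "tens R M N \<in> bilin R M N (tensor R M N)"
proof -
  note [simp] = cls_add cls_smult gen_closed cls_eq_iff
  have add_left: "tens R M N (m \<oplus>\<^bsub>M\<^esub> m') n = tens R M N m n \<oplus>\<^bsub>tensor R M N\<^esub> tens R M N m' n"
    if [simp]: "m \<in> carrier M" "m' \<in> carrier M" "n \<in> carrier N" for m m' n
  proof -
    have "gen (m \<oplus>\<^bsub>M\<^esub> m') n \<ominus>\<^bsub>F\<^esub> (gen m n \<oplus>\<^bsub>F\<^esub> gen m' n) \<in> K"
      by (rule subsetD[OF null_rels], unfold tensor_rels_def Let_def, rule UnI1, rule UnI1, rule UnI1)
        (rule CollectI, rule exI[of _ m], rule exI[of _ m'], rule exI[of _ n], simp)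
    then show ?thesis by (simp add: tens_cls)
  qed
  have add_right: "tens R M N m (n \<oplus>\<^bsub>N\<^esub> n') = tens R M N m n \<oplus>\<^bsub>tensor R M N\<^esub> tens R M N m n'"
    if [simp]: "m \<in> carrier M" "n \<in> carrier N" "n' \<in> carrier N" for m n n'
  proof -
    have "gen m (n \<oplus>\<^bsub>N\<^esub> n') \<ominus>\<^bsub>F\<^esub> (gen m n \<oplus>\<^bsub>F\<^esub> gen m n') \<in> K"
      by (rule subsetD[OF null_rels], unfold tensor_rels_def Let_def, rule UnI1, rule UnI1, rule UnI2)
        (rule CollectI, rule exI[of _ m], rule exI[of _ n], rule exI[of _ n'], simp)
    then show ?thesis by (simp add: tens_cls)
  qed
  have smult_left: "tens R M N (a \<odot>\<^bsub>M\<^esub> m) n = a \<odot>\<^bsub>tensor R M N\<^esub> tens R M N m n"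
    if [simp]: "a \<in> carrier R" "m \<in> carrier M" "n \<in> carrier N" for a m n
  proof -
    have "gen (a \<odot>\<^bsub>M\<^esub> m) n \<ominus>\<^bsub>F\<^esub> (a \<odot>\<^bsub>F\<^esub> gen m n) \<in> K"
      by (rule subsetD[OF null_rels], unfold tensor_rels_def Let_def, rule UnI1, rule UnI2)
        (rule CollectI, rule exI[of _ a], rule exI[of _ m], rule exI[of _ n], simp)
    then show ?thesis by (simp add: tens_cls)
  qed
  have smult_right: "tens R M N m (a \<odot>\<^bsub>N\<^esub> n) = a \<odot>\<^bsub>tensor R M N\<^esub> tens R M N m n"
    if [simp]: "a \<in> carrier R" "m \<in> carrier M" "n \<in> carrier N" for a m n
  proof -
    have "gen m (a \<odot>\<^bsub>N\<^esub> n) \<ominus>\<^bsub>F\<^esub> (a \<odot>\<^bsub>F\<^esub> gen m n) \<in> K"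
      by (rule subsetD[OF null_rels], unfold tensor_rels_def Let_def, rule UnI2)
        (rule CollectI, rule exI[of _ a], rule exI[of _ m], rule exI[of _ n], simp)
    then show ?thesis by (simp add: tens_cls)
  qed
  show ?thesis
    by (intro bilinI lin_mapI) (simp_all add: tens_closed add_left add_right smult_left smult_right)
qed

text \<open>
  Scalars need no case of their own, as they can be absorbed into the first factor of an
  elementary tensor.
\<close>

lemma tensor_induct [consumes 1, case_names zero step]:
  assumes t: "t \<in> carrier (tensor R M N)"
    and zero: "Q \<zero>\<^bsub>tensor R M N\<^esub>"
    and step: "\<And>m n t. \<lbrakk>m \<in> carrier M; n \<in> carrier N; t \<in> carrier (tensor R M N); Q t\<rbrakk> \<Longrightarrow>
      Q (tens R M N m n \<oplus>\<^bsub>tensor R M N\<^esub> t)"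
  shows "Q t"
proof -
  obtain f where f: "f \<in> carrier F" "t = cls f" using t by (rule cls_cases)
  have "Q (cls f)"
    using f(1) unfolding free_pairs_def
  proof (induction f rule: M.free_module_induct)
    case zero
    have "cls (\<lambda>s. \<zero>\<^bsub>R\<^esub>) = \<zero>\<^bsub>tensor R M N\<^esub>"
      using cls_zero by (simp add: free_pairs_def free_module_simps)
    then show ?case using assms(2) by (simp add: free_pairs_def)
  next
    case (step a s f)
    obtain m n where s: "s = (m, n)" "m \<in> carrier M" "n \<in> carrier N" using step.hyps(2) by auto
    have f: "f \<in> carrier F" using step by (simp add: free_pairs_def)
    have "cls (a \<odot>\<^bsub>F\<^esub> gen m n \<oplus>\<^bsub>F\<^esub> f) = a \<odot>\<^bsub>tensor R M N\<^esub> tens R M N m n \<oplus>\<^bsub>tensor R M N\<^esub> cls f"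
      using step.hyps(1) s f by (simp add: tens_cls cls_add cls_smult gen_closed)
    also have "a \<odot>\<^bsub>tensor R M N\<^esub> tens R M N m n = tens R M N (a \<odot>\<^bsub>M\<^esub> m) n"
      using lin_map_smult[OF bilin_left[OF tens_bilin s(3)] step.hyps(1) s(2)] by simp
    finally show ?case
      using assms(3)[OF M.smult_closed[OF step.hyps(1) s(2)] s(3) cls_closed[OF f]] step.IH s(1)
      by (simp add: free_pairs_def)
  qed
  then show ?thesis using f by simp
qed

text \<open>
  The kernel of the linear extension of a bilinear \<open>b\<close> is a submodule containing the bilinearity
  relations, hence contains \<open>K\<close>. So the extension is constant on cosets, and the representative
  picked by \<open>tlift\<close> may be replaced by any other.
\<close>

lemma tlift_cls:
  assumes P: "module R P" and b: "b \<in> bilin R M N P" and f: "f \<in> carrier F"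
  shows "tlift R M N P b (cls f) = lin_ext R P (\<lambda>s. b (fst s) (snd s)) f"
proof -
  interpret P: module R P by fact
  let ?b = "\<lambda>s. b (fst s) (snd s)"
  let ?e = "lin_ext R P ?b"
  have bS: "?b \<in> carrier M \<times> carrier N \<rightarrow> carrier P"
    using bilin_closed[OF b] by auto
  have lin: "?e \<in> lin_map R F P"
    unfolding free_pairs_def by (rule lin_ext_lin[OF P bS])
  note gen = lin_ext_gen[OF P bS]
  have neg: "?e (\<ominus>\<^bsub>F\<^esub> g) = \<ominus>\<^bsub>P\<^esub> ?e g" if g: "g \<in> carrier F" for g
  proof -
    have eg: "?e g \<in> carrier P" using lin_map_closed[OF lin g] .
    have "\<ominus>\<^bsub>F\<^esub> g = (\<ominus>\<^bsub>R\<^esub> \<one>\<^bsub>R\<^esub>) \<odot>\<^bsub>F\<^esub> g" using g by (simp add: F.smult_l_minus)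
    then have "?e (\<ominus>\<^bsub>F\<^esub> g) = (\<ominus>\<^bsub>R\<^esub> \<one>\<^bsub>R\<^esub>) \<odot>\<^bsub>P\<^esub> ?e g"
      using lin_map_smult[OF lin _ g, of "\<ominus>\<^bsub>R\<^esub> \<one>\<^bsub>R\<^esub>"] by simp
    then show ?thesis using eg by (simp add: P.smult_l_minus)
  qed
  have diff: "?e (g \<ominus>\<^bsub>F\<^esub> h) = ?e g \<ominus>\<^bsub>P\<^esub> ?e h" if "g \<in> carrier F" "h \<in> carrier F" for g h
    using that by (simp add: F.minus_eq P.minus_eq lin_map_add[OF lin] neg)
  define L where "L = {g \<in> carrier F. ?e g = \<zero>\<^bsub>P\<^esub>}"
  have "submodule L R F"
    using F.module_axioms
    by (intro F.submoduleI)
      (auto simp: L_def lin_map_add[OF lin] lin_map_smult[OF lin] neg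
        lin_map_zero[OF F.module_axioms P lin])
  moreover have "tensor_rels R M N \<subseteq> L"
  proof -
    have bl: "b (m \<oplus>\<^bsub>M\<^esub> m') n = b m n \<oplus>\<^bsub>P\<^esub> b m' n"
      if "m \<in> carrier M" "m' \<in> carrier M" "n \<in> carrier N" for m m' n
      using lin_map_add[OF bilin_left[OF b]] that by blast
    have br: "b m (n \<oplus>\<^bsub>N\<^esub> n') = b m n \<oplus>\<^bsub>P\<^esub> b m n'"
      if "m \<in> carrier M" "n \<in> carrier N" "n' \<in> carrier N" for m n n'
      using lin_map_add[OF bilin_right[OF b]] that by blast
    have bsl: "b (a \<odot>\<^bsub>M\<^esub> m) n = a \<odot>\<^bsub>P\<^esub> b m n"
      if "a \<in> carrier R" "m \<in> carrier M" "n \<in> carrier N" for a m n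
      using lin_map_smult[OF bilin_left[OF b]] that by blast
    have bsr: "b m (a \<odot>\<^bsub>N\<^esub> n) = a \<odot>\<^bsub>P\<^esub> b m n"
      if "a \<in> carrier R" "m \<in> carrier M" "n \<in> carrier N" for a m n
      using lin_map_smult[OF bilin_right[OF b]] that by blast
    show ?thesis
      unfolding tensor_rels_def Let_def
      by (auto simp: L_def diff gen_closed gen bl br bsl bsr lin_map_add[OF lin]
          lin_map_smult[OF lin] bilin_closed[OF b] P.minus_eq P.r_neg)
  qed
  ultimately have KL: "K \<subseteq> L" by (rule null_least)
  \<comment> \<open>The representative chosen by \<open>tlift\<close> differs from \<open>f\<close> by an element of \<open>K\<close>.\<close>
  define g where "g = (SOME g. g \<in> cls f)"
  have "g \<in> cls f" unfolding g_def using someI[of "\<lambda>g. g \<in> cls f", OF K.a_rcos_self[OF f]] .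
  then have g: "g \<in> carrier F" "g \<ominus>\<^bsub>F\<^esub> f \<in> K"
    using K.a_elemrcos_carrier[OF f] K.a_rcos_module[OF f] by (auto simp: F.minus_eq)
  then have "?e g \<ominus>\<^bsub>P\<^esub> ?e f = \<zero>\<^bsub>P\<^esub>" using KL f by (auto simp: L_def diff)
  then have "\<ominus>\<^bsub>P\<^esub> (\<ominus>\<^bsub>P\<^esub> ?e f) = ?e g"
    using lin_map_closed[OF lin g(1)] lin_map_closed[OF lin f]
    by (intro P.minus_equality) (simp_all add: P.minus_eq)
  then have "?e g = ?e f" using lin_map_closed[OF lin f] by simp
  then show ?thesis by (simp add: tlift_def Let_def lin_ext_def g_def)
qed

end

text \<open>
  The universal property is stated outside the locale with \<open>module\<close> premises, so that it applies
  to tensor products of tensor products by backchaining.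
\<close>

lemma tensor_module [intro, simp]: "\<lbrakk>module R M; module R N\<rbrakk> \<Longrightarrow> module R (tensor R M N)"
  by (rule tensor_product.module_tensor) (rule tensor_product.intro)

lemma tens_closed [intro, simp]:
  "\<lbrakk>module R M; module R N; m \<in> carrier M; n \<in> carrier N\<rbrakk> \<Longrightarrow>
    tens R M N m n \<in> carrier (tensor R M N)"
  by (rule tensor_product.tens_closed) (auto intro: tensor_product.intro)

lemma tens_bilin: "\<lbrakk>module R M; module R N\<rbrakk> \<Longrightarrow> tens R M N \<in> bilin R M N (tensor R M N)"
  by (rule tensor_product.tens_bilin) (rule tensor_product.intro)

lemma tlift_lin:
  assumes "module R M" "module R N" and P: "module R P" and b: "b \<in> bilin R M N P"
  shows "tlift R M N P b \<in> lin_map R (tensor R M N) P"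
proof -
  interpret tensor_product R M N using assms(1,2) by (rule tensor_product.intro)
  have bS: "(\<lambda>s. b (fst s) (snd s)) \<in> carrier M \<times> carrier N \<rightarrow> carrier P"
    using bilin_closed[OF b] by auto
  have lin: "lin_ext R P (\<lambda>s. b (fst s) (snd s)) \<in> lin_map R F P"
    unfolding free_pairs_def by (rule lin_ext_lin[OF P bS])
  show ?thesis
    by (rule lin_mapI; elim cls_cases)
      (simp_all add: cls_add cls_smult tlift_cls[OF P b] lin_map_add[OF lin]
        lin_map_smult[OF lin] lin_map_closed[OF lin])
qed

lemma tlift_tens:
  assumes "module R M" "module R N" and P: "module R P" and b: "b \<in> bilin R M N P"
    and "m \<in> carrier M" "n \<in> carrier N"
  shows "tlift R M N P b (tens R M N m n) = b m n"
proof -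
  interpret tensor_product R M N using assms(1,2) by (rule tensor_product.intro)
  have bS: "(\<lambda>s. b (fst s) (snd s)) \<in> carrier M \<times> carrier N \<rightarrow> carrier P"
    using bilin_closed[OF b] by auto
  show ?thesis
    using lin_ext_gen[OF P bS, of "(m, n)"] assms(5,6)
    by (simp add: tens_cls tlift_cls[OF P b gen_closed])
qed

lemma tensor_eqI:
  assumes M: "module R M" and N: "module R N" and P: "module R P"
    and f: "f \<in> lin_map R (tensor R M N) P" and g: "g \<in> lin_map R (tensor R M N) P"
    and eq: "\<And>m n. \<lbrakk>m \<in> carrier M; n \<in> carrier N\<rbrakk> \<Longrightarrow> f (tens R M N m n) = g (tens R M N m n)"
    and t: "t \<in> carrier (tensor R M N)"
  shows "f t = g t"
proof -
  interpret tensor_product R M N using M N by (rule tensor_product.intro)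
  show ?thesis
    using t
  proof (induction t rule: tensor_induct)
    case zero
    show ?case using lin_map_zero[OF module_tensor P f] lin_map_zero[OF module_tensor P g] by simp
  next
    case (step m n t)
    then show ?case
      by (simp add: lin_map_add[OF f] lin_map_add[OF g] tens_closed eq)
  qed
qed

lemma tlift_cong:
  assumes M: "module R M" and N: "module R N" and t: "t \<in> carrier (tensor R M N)"
    and eq: "\<And>m n. \<lbrakk>m \<in> carrier M; n \<in> carrier N\<rbrakk> \<Longrightarrow> b m n = c m n"
    and P: "module R P" and c: "c \<in> bilin R M N P"
  shows "tlift R M N P b t = tlift R M N P c t"
proof -
  interpret M: module R M by fact
  interpret N: module R N by fact
  have b: "b \<in> bilin R M N P"
    by (intro bilinI)
      (use eq in \<open>auto intro: lin_map_cong[OF N bilin_right[OF c]] lin_map_cong[OF M bilin_left[OF c]]\<close>)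
  show ?thesis
    by (rule tensor_eqI[OF M N P tlift_lin[OF M N P b] tlift_lin[OF M N P c] _ t])
      (simp add: tlift_tens[OF M N P] b c eq)
qed


section \<open>Closure properties of linear maps\<close>

lemma lin_map_sum:
  assumes "module R P" "f \<in> lin_map R M P" "g \<in> lin_map R M P"
  shows "(\<lambda>x. f x \<oplus>\<^bsub>P\<^esub> g x) \<in> lin_map R M P"
proof -
  interpret P: module R P by fact
  show ?thesis
    by (rule lin_mapI)
      (simp_all add: lin_map_closed[OF assms(2)] lin_map_closed[OF assms(3)]
        lin_map_add[OF assms(2)] lin_map_add[OF assms(3)]
        lin_map_smult[OF assms(2)] lin_map_smult[OF assms(3)] P.a_ac P.smult_r_distr)
qed

lemma lin_map_scale:
  assumes "module R P" "a \<in> carrier R" "f \<in> lin_map R M P"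
  shows "(\<lambda>x. a \<odot>\<^bsub>P\<^esub> f x) \<in> lin_map R M P"
proof -
  interpret P: module R P by fact
  show ?thesis
    by (rule lin_mapI)
      (simp_all add: lin_map_closed[OF assms(3)] lin_map_add[OF assms(3)] lin_map_smult[OF assms(3)]
        assms(2) P.smult_r_distr P.smult_assoc1[symmetric] P.m_comm)
qed

lemma tens_lin_left:
  "\<lbrakk>module R M; module R N; f \<in> lin_map R Q M; n \<in> carrier N\<rbrakk> \<Longrightarrow>
    (\<lambda>x. tens R M N (f x) n) \<in> lin_map R Q (tensor R M N)"
  by (rule lin_map_comp[OF _ bilin_left[OF tens_bilin]])

lemma tens_lin_right:
  "\<lbrakk>module R M; module R N; f \<in> lin_map R Q N; m \<in> carrier M\<rbrakk> \<Longrightarrow>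
    (\<lambda>x. tens R M N m (f x)) \<in> lin_map R Q (tensor R M N)"
  by (rule lin_map_comp[OF _ bilin_right[OF tens_bilin]])

lemma tlift_comp_lin:
  "\<lbrakk>module R M; module R N; module R P; f \<in> lin_map R Q (tensor R M N); b \<in> bilin R M N P\<rbrakk> \<Longrightarrow>
    (\<lambda>x. tlift R M N P b (f x)) \<in> lin_map R Q P"
  by (rule lin_map_comp[OF _ tlift_lin])

lemma tlift_closed:
  "\<lbrakk>module R M; module R N; module R P; b \<in> bilin R M N P; t \<in> carrier (tensor R M N)\<rbrakk> \<Longrightarrow>
    tlift R M N P b t \<in> carrier P"
  using lin_map_closed[OF tlift_lin] .

text \<open>
  Both sides are linear in \<open>t\<close>. In Sweedler notation, linear maps can be moved inside the
  expression \<open>b(t\<^sub>1, t\<^sub>2)\<close>.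
\<close>

lemma lin_tlift:
  assumes M: "module R M" and N: "module R N" and P: "module R P" and Q: "module R Q"
    and b: "b \<in> bilin R M N P" and f: "f \<in> lin_map R P Q" and t: "t \<in> carrier (tensor R M N)"
  shows "f (tlift R M N P b t) = tlift R M N Q (\<lambda>m n. f (b m n)) t"
  by (rule tensor_eqI[OF M N Q _ _ _ t])
    (use bilin_comp[OF b f] in
      \<open>auto intro: lin_map_comp[OF tlift_lin[OF M N P b] f] tlift_lin[OF M N Q]
        simp: tlift_tens[OF M N P b] tlift_tens[OF M N Q]\<close>)

text \<open>This makes expressions such as \<open>f(h\<^sub>1) g(h\<^sub>2)\<close> linear in \<open>f\<close>, which occurs inside the lifted map.\<close>

lemma tlift_param_lin:
  assumes Q: "module R Q" and M: "module R M" and N: "module R N" and P: "module R P"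
    and t: "t \<in> carrier (tensor R M N)"
    and b: "\<And>x. x \<in> carrier Q \<Longrightarrow> b x \<in> bilin R M N P"
    and lin: "\<And>m n. \<lbrakk>m \<in> carrier M; n \<in> carrier N\<rbrakk> \<Longrightarrow> (\<lambda>x. b x m n) \<in> lin_map R Q P"
  shows "(\<lambda>x. tlift R M N P (b x) t) \<in> lin_map R Q P"
proof -
  interpret Q: module R Q by fact
  note tl = tlift_lin[OF M N P b] and tt = tlift_tens[OF M N P b]
  show ?thesis
  proof (rule lin_mapI)
    show "tlift R M N P (b x) t \<in> carrier P" if "x \<in> carrier Q" for x
      using tlift_closed[OF M N P b[OF that] t] .
    show "tlift R M N P (b (x \<oplus>\<^bsub>Q\<^esub> y)) t = tlift R M N P (b x) t \<oplus>\<^bsub>P\<^esub> tlift R M N P (b y) t"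
      if "x \<in> carrier Q" "y \<in> carrier Q" for x y
      by (rule tensor_eqI[OF M N P tl lin_map_sum[OF P tl tl] _ t])
        (use that in \<open>simp_all add: tt lin_map_add[OF lin]\<close>)
    show "tlift R M N P (b (a \<odot>\<^bsub>Q\<^esub> x)) t = a \<odot>\<^bsub>P\<^esub> tlift R M N P (b x) t"
      if "a \<in> carrier R" "x \<in> carrier Q" for a x
      by (rule tensor_eqI[OF M N P tl lin_map_scale[OF P _ tl] _ t])
        (use that in \<open>simp_all add: tt lin_map_smult[OF lin]\<close>)
  qed
qed


section \<open>Algebras and their tensor products\<close>

lemma base_algebra_simps [simp]:
  "carrier (base_algebra R) = carrier R"
  "x \<otimes>\<^bsub>base_algebra R\<^esub> y = x \<otimes>\<^bsub>R\<^esub> y"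
  "\<one>\<^bsub>base_algebra R\<^esub> = \<one>\<^bsub>R\<^esub>"
  "\<zero>\<^bsub>base_algebra R\<^esub> = \<zero>\<^bsub>R\<^esub>"
  "x \<oplus>\<^bsub>base_algebra R\<^esub> y = x \<oplus>\<^bsub>R\<^esub> y"
  "x \<odot>\<^bsub>base_algebra R\<^esub> y = x \<otimes>\<^bsub>R\<^esub> y"
  by (simp_all add: base_algebra_def)

lemma (in cring) base_module: "module R (base_algebra R)"
  by (rule moduleI, rule cring_axioms, rule abelian_groupI)
    (auto simp: a_ac m_ac l_distr r_distr intro: l_neg)

lemma smult_lin_left:
  assumes "module R N" "f \<in> lin_map R Q (base_algebra R)" "n \<in> carrier N"
  shows "(\<lambda>x. f x \<odot>\<^bsub>N\<^esub> n) \<in> lin_map R Q N"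
proof -
  interpret N: module R N by fact
  show ?thesis
    using assms(2,3) by (intro lin_mapI) (auto simp: lin_map_def N.smult_l_distr N.smult_assoc1 Pi_iff)
qed

lemma base_mult_lin_left:
  assumes "cring R" "f \<in> lin_map R Q (base_algebra R)" "a \<in> carrier R"
  shows "(\<lambda>x. f x \<otimes>\<^bsub>R\<^esub> a) \<in> lin_map R Q (base_algebra R)"
  using smult_lin_left[OF cring.base_module[OF assms(1)] assms(2)] assms(3) by simp

lemma base_mult_lin_right:
  assumes "cring R" "a \<in> carrier R" "f \<in> lin_map R Q (base_algebra R)"
  shows "(\<lambda>x. a \<otimes>\<^bsub>R\<^esub> f x) \<in> lin_map R Q (base_algebra R)"
  using lin_map_scale[OF cring.base_module[OF assms(1)] assms(2,3)] by simp

lemma mult_lin_left: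
  assumes "unital_algebra R A" "f \<in> lin_map R Q A" "a \<in> carrier A"
  shows "(\<lambda>x. f x \<otimes>\<^bsub>A\<^esub> a) \<in> lin_map R Q A"
proof -
  interpret A: unital_algebra R A by fact
  show ?thesis
    using assms(2,3) by (intro lin_mapI) (auto simp: lin_map_def A.smult_mult_left A.A.l_distr Pi_iff)
qed

lemma mult_lin_right:
  assumes "unital_algebra R A" "a \<in> carrier A" "f \<in> lin_map R Q A"
  shows "(\<lambda>x. a \<otimes>\<^bsub>A\<^esub> f x) \<in> lin_map R Q A"
proof -
  interpret A: unital_algebra R A by fact
  show ?thesis
    using assms(2,3) by (intro lin_mapI) (auto simp: lin_map_def A.smult_mult_right A.A.r_distr Pi_iff)
qed

lemma unital_algebra_module: "unital_algebra R A \<Longrightarrow> module R A"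
  by (simp add: unital_algebra_def)

text \<open>
  Read backwards, these rules follow the shape of a term and prove that it is linear
  in a variable that occurs once.
\<close>

lemmas lin_intros = bilinI lin_map_id tens_lin_left tens_lin_right mult_lin_left mult_lin_right
  smult_lin_left lin_map_scale base_mult_lin_left base_mult_lin_right
  tlift_comp_lin tlift_param_lin

lemma finsum_tensor_module: "finsum (tensor_module R M N) = finsum (tensor R M N)"
  by (simp add: fun_eq_iff finsum_def finprod_def tensor_def Let_def)

text \<open>
  The product of \<open>tensor\<close> is defined by lifts into \<open>tensor_module\<close>, which has the same vector
  space structure.
\<close>

lemma tlift_tensor_module:
  "tlift R M N (tensor_module R P Q) = tlift R M N (tensor R P Q)"
proof -
  have "smult (tensor_module R P Q) = smult (tensor R P Q)"
    by (simp add: fun_eq_iff tensor_def Let_def)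
  then show ?thesis
    by (simp add: fun_eq_iff tlift_def finsum_tensor_module)
qed

locale algebra_pair = A: unital_algebra R A + B: unital_algebra R B
  for R :: "('k, 'r) ring_scheme" and A :: "('k, 'a, 'x) module_scheme"
    and B :: "('k, 'b, 'y) module_scheme"
begin

abbreviation "T \<equiv> tensor R A B"

lemma module_facts [simp, intro]: "module R A" "module R B" "module R T"
  "unital_algebra R A" "unital_algebra R B"
  by (auto intro: A.module_axioms B.module_axioms A.unital_algebra_axioms B.unital_algebra_axioms)

interpretation T: module R T by simp

lemma elem_mult_bilin:
  assumes "a \<in> carrier A" "b \<in> carrier B"
  shows "(\<lambda>a' b'. tens R A B (a \<otimes>\<^bsub>A\<^esub> a') (b \<otimes>\<^bsub>B\<^esub> b')) \<in> bilin R A B T"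
  by (intro lin_intros) (use assms in auto)

lemma mult_tlift: "s \<otimes>\<^bsub>T\<^esub> t =
    tlift R A B T (\<lambda>a b. tlift R A B T (\<lambda>a' b'. tens R A B (a \<otimes>\<^bsub>A\<^esub> a') (b \<otimes>\<^bsub>B\<^esub> b')) t) s"
  by (simp add: tensor_simps tlift_tensor_module)

lemma outer_bilin:
  assumes "t \<in> carrier T"
  shows "(\<lambda>a b. tlift R A B T (\<lambda>a' b'. tens R A B (a \<otimes>\<^bsub>A\<^esub> a') (b \<otimes>\<^bsub>B\<^esub> b')) t) \<in> bilin R A B T"
  by (intro lin_intros) (use assms in auto)

lemma mult_bilin: "(\<lambda>s t. s \<otimes>\<^bsub>T\<^esub> t) \<in> bilin R T T T"
  unfolding mult_tlift
  by (intro lin_intros outer_bilin elem_mult_bilin) auto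

lemma mult_tens:
  assumes "a \<in> carrier A" "b \<in> carrier B" "a' \<in> carrier A" "b' \<in> carrier B"
  shows "tens R A B a b \<otimes>\<^bsub>T\<^esub> tens R A B a' b' = tens R A B (a \<otimes>\<^bsub>A\<^esub> a') (b \<otimes>\<^bsub>B\<^esub> b')"
  unfolding mult_tlift
  using assms by (simp add: tlift_tens outer_bilin elem_mult_bilin)

lemma T_mult_lin_left: "\<lbrakk>f \<in> lin_map R Q T; t \<in> carrier T\<rbrakk> \<Longrightarrow> (\<lambda>x. f x \<otimes>\<^bsub>T\<^esub> t) \<in> lin_map R Q T"
  by (rule lin_map_comp[OF _ bilin_left[OF mult_bilin]])

lemma T_mult_lin_right: "\<lbrakk>t \<in> carrier T; f \<in> lin_map R Q T\<rbrakk> \<Longrightarrow> (\<lambda>x. t \<otimes>\<^bsub>T\<^esub> f x) \<in> lin_map R Q T"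
  by (rule lin_map_comp[OF _ bilin_right[OF mult_bilin]])

lemmas T_lin = lin_map_id T_mult_lin_left T_mult_lin_right

lemma mult_closed: "\<lbrakk>s \<in> carrier T; t \<in> carrier T\<rbrakk> \<Longrightarrow> s \<otimes>\<^bsub>T\<^esub> t \<in> carrier T"
  by (rule bilin_closed[OF mult_bilin])

text \<open>
  Both sides are linear in each of the three arguments, so it suffices to compare them on
  elementary tensors.
\<close>

lemma mult_assoc:
  assumes s: "s \<in> carrier T" and t: "t \<in> carrier T" and u: "u \<in> carrier T"
  shows "(s \<otimes>\<^bsub>T\<^esub> t) \<otimes>\<^bsub>T\<^esub> u = s \<otimes>\<^bsub>T\<^esub> (t \<otimes>\<^bsub>T\<^esub> u)"
proof (rule tensor_eqI[where t = s, OF _ _ _ _ _ _ s])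
  fix a b assume ab: "a \<in> carrier A" "b \<in> carrier B"
  show "(tens R A B a b \<otimes>\<^bsub>T\<^esub> t) \<otimes>\<^bsub>T\<^esub> u = tens R A B a b \<otimes>\<^bsub>T\<^esub> (t \<otimes>\<^bsub>T\<^esub> u)"
  proof (rule tensor_eqI[where t = t, OF _ _ _ _ _ _ t])
    fix c d assume cd: "c \<in> carrier A" "d \<in> carrier B"
    show "(tens R A B a b \<otimes>\<^bsub>T\<^esub> tens R A B c d) \<otimes>\<^bsub>T\<^esub> u =
        tens R A B a b \<otimes>\<^bsub>T\<^esub> (tens R A B c d \<otimes>\<^bsub>T\<^esub> u)"
    proof (rule tensor_eqI[where t = u, OF _ _ _ _ _ _ u])
      fix e f assume ef: "e \<in> carrier A" "f \<in> carrier B"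
      show "(tens R A B a b \<otimes>\<^bsub>T\<^esub> tens R A B c d) \<otimes>\<^bsub>T\<^esub> tens R A B e f =
          tens R A B a b \<otimes>\<^bsub>T\<^esub> (tens R A B c d \<otimes>\<^bsub>T\<^esub> tens R A B e f)"
        using ab cd ef by (simp add: mult_tens A.A.m_assoc B.A.m_assoc)
    qed (use ab cd in \<open>auto intro!: T_lin mult_closed\<close>)
  qed (use ab u in \<open>auto intro!: T_lin mult_closed\<close>)
qed (use t u in \<open>auto intro!: T_lin mult_closed\<close>)

lemma one_tens: "\<one>\<^bsub>T\<^esub> = tens R A B \<one>\<^bsub>A\<^esub> \<one>\<^bsub>B\<^esub>"
  by (simp add: tensor_simps)

lemma one_closed: "\<one>\<^bsub>T\<^esub> \<in> carrier T"
  by (simp add: one_tens)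

lemma one_mult:
  assumes t: "t \<in> carrier T"
  shows "\<one>\<^bsub>T\<^esub> \<otimes>\<^bsub>T\<^esub> t = t" "t \<otimes>\<^bsub>T\<^esub> \<one>\<^bsub>T\<^esub> = t"
proof -
  show "\<one>\<^bsub>T\<^esub> \<otimes>\<^bsub>T\<^esub> t = t"
    by (rule tensor_eqI[where t = t and M = A and N = B and P = T, OF _ _ _ T_mult_lin_right lin_map_id _ t])
      (auto intro: one_closed lin_map_id simp: one_tens mult_tens)
  show "t \<otimes>\<^bsub>T\<^esub> \<one>\<^bsub>T\<^esub> = t"
    by (rule tensor_eqI[where t = t and M = A and N = B and P = T, OF _ _ _ T_mult_lin_left lin_map_id _ t])
      (auto intro: one_closed lin_map_id simp: one_tens mult_tens)
qed

lemma unital_algebra_tensor: "unital_algebra R T"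
proof (intro unital_algebra.intro ringI unital_algebra_axioms.intro monoidI)
  show "module R T" "abelian_group T" by (simp, rule T.abelian_group_axioms)
qed (use lin_map_add[OF bilin_left[OF mult_bilin]] lin_map_add[OF bilin_right[OF mult_bilin]]
    lin_map_smult[OF bilin_left[OF mult_bilin]] lin_map_smult[OF bilin_right[OF mult_bilin]] in
    \<open>auto simp: one_closed one_mult mult_closed mult_assoc\<close>)

end

lemma unital_algebra_tensor [intro, simp]:
  "\<lbrakk>unital_algebra R A; unital_algebra R B\<rbrakk> \<Longrightarrow> unital_algebra R (tensor R A B)"
  by (rule algebra_pair.unital_algebra_tensor) (rule algebra_pair.intro)

lemma tens_mult:
  "\<lbrakk>unital_algebra R A; unital_algebra R B; a \<in> carrier A; b \<in> carrier B; a' \<in> carrier A; b' \<in> carrier B\<rbrakk>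
    \<Longrightarrow> tens R A B a b \<otimes>\<^bsub>tensor R A B\<^esub> tens R A B a' b' = tens R A B (a \<otimes>\<^bsub>A\<^esub> a') (b \<otimes>\<^bsub>B\<^esub> b')"
  by (rule algebra_pair.mult_tens) (auto intro: algebra_pair.intro)


section \<open>Canonical maps between tensor products\<close>

lemma tens_map_bilin:
  assumes "module R P" "module R Q" "f \<in> lin_map R M P" "g \<in> lin_map R N Q"
  shows "(\<lambda>m n. tens R P Q (f m) (g n)) \<in> bilin R M N (tensor R P Q)"
  by (intro bilinI tens_lin_left tens_lin_right lin_map_closed[OF assms(3)] lin_map_closed[OF assms(4)]
      assms)

lemma tens_map_lin:
  assumes "module R M" "module R N" "module R P" "module R Q" "f \<in> lin_map R M P" "g \<in> lin_map R N Q"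
  shows "tens_map R M N P Q f g \<in> lin_map R (tensor R M N) (tensor R P Q)"
  unfolding tens_map_def by (intro tlift_lin tens_map_bilin tensor_module assms)

lemma tens_map_tens:
  assumes "module R M" "module R N" "module R P" "module R Q" "f \<in> lin_map R M P" "g \<in> lin_map R N Q"
    and "m \<in> carrier M" "n \<in> carrier N"
  shows "tens_map R M N P Q f g (tens R M N m n) = tens R P Q (f m) (g n)"
  unfolding tens_map_def by (intro tlift_tens tens_map_bilin tensor_module assms)

lemma tens_flip_bilin:
  assumes "module R M" "module R N"
  shows "(\<lambda>m n. tens R N M n m) \<in> bilin R M N (tensor R N M)"
  by (intro lin_intros assms)

lemma tens_flip_lin:
  assumes "module R M" "module R N"
  shows "tens_flip R M N \<in> lin_map R (tensor R M N) (tensor R N M)"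
  unfolding tens_flip_def by (intro tlift_lin tens_flip_bilin tensor_module assms)

lemma tens_flip_tens:
  assumes "module R M" "module R N" "m \<in> carrier M" "n \<in> carrier N"
  shows "tens_flip R M N (tens R M N m n) = tens R N M n m"
  unfolding tens_flip_def by (intro tlift_tens tens_flip_bilin tensor_module assms)

lemma assoc_inner_bilin:
  assumes "module R M" "module R N" "module R P" "p \<in> carrier P"
  shows "(\<lambda>m n. tens R M (tensor R N P) m (tens R N P n p)) \<in> bilin R M N (tensor R M (tensor R N P))"
  by (intro lin_intros tensor_module tens_closed assms)

lemma assoc_outer_bilin:
  assumes "module R M" "module R N" "module R P"
  shows "(\<lambda>t p. tlift R M N (tensor R M (tensor R N P))
      (\<lambda>m n. tens R M (tensor R N P) m (tens R N P n p)) t)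
    \<in> bilin R (tensor R M N) P (tensor R M (tensor R N P))"
  by (intro lin_intros tensor_module tens_closed assms; assumption)

lemma tens_assoc_lin:
  assumes "module R M" "module R N" "module R P"
  shows "tens_assoc R M N P \<in> lin_map R (tensor R (tensor R M N) P) (tensor R M (tensor R N P))"
  unfolding tens_assoc_def Let_def by (intro tlift_lin assoc_outer_bilin tensor_module assms)

lemma tens_assoc_tens:
  assumes "module R M" "module R N" "module R P" "t \<in> carrier (tensor R M N)" "p \<in> carrier P"
  shows "tens_assoc R M N P (tens R (tensor R M N) P t p) =
    tlift R M N (tensor R M (tensor R N P)) (\<lambda>m n. tens R M (tensor R N P) m (tens R N P n p)) t"
  unfolding tens_assoc_def Let_def
  by (intro tlift_tens[where b = "\<lambda>t p. tlift R M N (tensor R M (tensor R N P))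
      (\<lambda>m n. tens R M (tensor R N P) m (tens R N P n p)) t"] assoc_outer_bilin tensor_module assms)

lemma leg13_bilin:
  assumes "module R M" "module R N" "module R P" "\<one>\<^bsub>N\<^esub> \<in> carrier N"
  shows "(\<lambda>m p. tens R M (tensor R N P) m (tens R N P \<one>\<^bsub>N\<^esub> p)) \<in> bilin R M P (tensor R M (tensor R N P))"
  by (intro lin_intros tensor_module tens_closed assms)

lemma leg13_lin:
  assumes "module R M" "module R N" "module R P" "\<one>\<^bsub>N\<^esub> \<in> carrier N"
  shows "leg13 R M N P \<in> lin_map R (tensor R M P) (tensor R M (tensor R N P))"
  unfolding leg13_def by (intro tlift_lin leg13_bilin tensor_module assms)

lemma leg13_tens:
  assumes "module R M" "module R N" "module R P" "\<one>\<^bsub>N\<^esub> \<in> carrier N" "m \<in> carrier M" "p \<in> carrier P"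
  shows "leg13 R M N P (tens R M P m p) = tens R M (tensor R N P) m (tens R N P \<one>\<^bsub>N\<^esub> p)"
  unfolding leg13_def by (intro tlift_tens leg13_bilin tensor_module assms)


section \<open>The dual algebra\<close>

lemma dual_simps:
  "carrier (dual R H) = lin_map R H (base_algebra R) \<inter> extensional (carrier H)"
  "\<theta> \<otimes>\<^bsub>dual R H\<^esub> \<theta>' = (\<lambda>h\<in>carrier H.
     tlift R H H (base_algebra R) (\<lambda>a b. \<theta> a \<otimes>\<^bsub>R\<^esub> \<theta>' b) (comult H h))"
  "\<one>\<^bsub>dual R H\<^esub> = (\<lambda>h\<in>carrier H. counit H h)"
  "\<zero>\<^bsub>dual R H\<^esub> = (\<lambda>h\<in>carrier H. \<zero>\<^bsub>R\<^esub>)"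
  "\<theta> \<oplus>\<^bsub>dual R H\<^esub> \<theta>' = (\<lambda>h\<in>carrier H. \<theta> h \<oplus>\<^bsub>R\<^esub> \<theta>' h)"
  "c \<odot>\<^bsub>dual R H\<^esub> \<theta> = (\<lambda>h\<in>carrier H. c \<otimes>\<^bsub>R\<^esub> \<theta> h)"
  "comult (dual R H) = dual_comult R H"
  "counit (dual R H) \<theta> = \<theta> \<one>\<^bsub>H\<^esub>"
  by (simp_all add: dual_def dual_algebra_def module.extend_def)

text \<open>
  The comultiplication of the dual is defined by tensors over the bare dual algebra; extending
  the record by the coalgebra maps changes none of these constructions.
\<close>

lemma tensor_dual_algebra:
  "free_pairs R (dual_algebra R H) (dual_algebra R H) = free_pairs R (dual R H) (dual R H)"
  "tensor_null R (dual_algebra R H) (dual_algebra R H) = tensor_null R (dual R H) (dual R H)"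
  "tensor R (dual_algebra R H) (dual_algebra R H) = tensor R (dual R H) (dual R H)"
  "tlift R (dual_algebra R H) (dual_algebra R H) = tlift R (dual R H) (dual R H)"
proof -
  have [simp]: "carrier (dual_algebra R H) = carrier (dual R H)"
      "add (dual_algebra R H) = add (dual R H)" "smult (dual_algebra R H) = smult (dual R H)"
      "monoid.mult (dual_algebra R H) = monoid.mult (dual R H)" "one (dual_algebra R H) = one (dual R H)"
    by (simp_all add: dual_def module.extend_def)
  show F: "free_pairs R (dual_algebra R H) (dual_algebra R H) = free_pairs R (dual R H) (dual R H)"
    by (simp add: free_pairs_def)
  show K: "tensor_null R (dual_algebra R H) (dual_algebra R H) = tensor_null R (dual R H) (dual R H)"
    by (simp add: tensor_null_def tensor_rels_def F)
  show L: "tlift R (dual_algebra R H) (dual_algebra R H) = tlift R (dual R H) (dual R H)"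
    by (simp add: tlift_def fun_eq_iff)
  show "tensor R (dual_algebra R H) (dual_algebra R H) = tensor R (dual R H) (dual R H)"
    by (simp add: tensor_def tensor_module_def F K L tens_def)
qed

lemma dual_lin: "\<theta> \<in> carrier (dual R H) \<Longrightarrow> \<theta> \<in> lin_map R H (base_algebra R)"
  by (simp add: dual_simps)

lemma dual_closed: "\<lbrakk>\<theta> \<in> carrier (dual R H); h \<in> carrier H\<rbrakk> \<Longrightarrow> \<theta> h \<in> carrier R"
  using lin_map_closed[OF dual_lin] by simp

lemma dual_eqI: "\<lbrakk>\<theta> \<in> carrier (dual R H); \<phi> \<in> carrier (dual R H); \<And>h. h \<in> carrier H \<Longrightarrow> \<theta> h = \<phi> h\<rbrakk> \<Longrightarrow> \<theta> = \<phi>"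
  by (auto simp: dual_simps intro: extensionalityI)

lemma restrict_dual:
  assumes mod_H: "module R H" and f: "f \<in> lin_map R H (base_algebra R)"
  shows "restrict f (carrier H) \<in> carrier (dual R H)"
  using lin_map_cong[OF mod_H f, of "restrict f (carrier H)"] by (simp add: dual_simps)

lemma dual_module:
  fixes R (structure)
  assumes mod_H: "module R H"
  shows "module R (dual R H)"
proof (rule moduleI)
  interpret H: module R H by fact
  note dual_eqI = dual_eqI[where R = R and H = H] and mod_k = H.R.base_module and restrict_dual = restrict_dual[OF mod_H]
  have add: "\<theta> \<oplus>\<^bsub>dual R H\<^esub> \<phi> \<in> carrier (dual R H)" if "\<theta> \<in> carrier (dual R H)" "\<phi> \<in> carrier (dual R H)" for \<theta> \<phi>
    unfolding dual_simps(5) using lin_map_sum[OF mod_k dual_lin[OF that(1)] dual_lin[OF that(2)]]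
    by (intro restrict_dual) simp
  have smult: "c \<odot>\<^bsub>dual R H\<^esub> \<theta> \<in> carrier (dual R H)" if "c \<in> carrier R" "\<theta> \<in> carrier (dual R H)" for c \<theta>
    unfolding dual_simps(6) using lin_map_scale[OF mod_k that(1) dual_lin[OF that(2)]]
    by (intro restrict_dual) simp
  have zero: "\<zero>\<^bsub>dual R H\<^esub> \<in> carrier (dual R H)"
    unfolding dual_simps(4) by (intro restrict_dual lin_mapI) auto
  note cl = add smult zero dual_closed[where R = R and H = H]
  note ev = dual_simps(4-6)
  show "cring R" by (rule H.R.cring_axioms)
  show "abelian_group (dual R H)"
  proof (rule abelian_groupI)
    show "\<exists>\<phi>\<in>carrier (dual R H). \<phi> \<oplus>\<^bsub>dual R H\<^esub> \<theta> = \<zero>\<^bsub>dual R H\<^esub>" if \<theta>: "\<theta> \<in> carrier (dual R H)" for \<theta>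
    proof
      show neg: "(\<ominus> \<one>) \<odot>\<^bsub>dual R H\<^esub> \<theta> \<in> carrier (dual R H)" using \<theta> by (simp add: smult)
      show "(\<ominus> \<one>) \<odot>\<^bsub>dual R H\<^esub> \<theta> \<oplus>\<^bsub>dual R H\<^esub> \<theta> = \<zero>\<^bsub>dual R H\<^esub>"
        by (rule dual_eqI, simp_all add: cl \<theta> neg)
        (simp add: ev cl \<theta> neg H.R.l_neg H.R.l_minus)
    qed
    show "\<theta> \<oplus>\<^bsub>dual R H\<^esub> \<phi> \<oplus>\<^bsub>dual R H\<^esub> \<psi> = \<theta> \<oplus>\<^bsub>dual R H\<^esub> (\<phi> \<oplus>\<^bsub>dual R H\<^esub> \<psi>)"
      if "\<theta> \<in> carrier (dual R H)" "\<phi> \<in> carrier (dual R H)" "\<psi> \<in> carrier (dual R H)" for \<theta> \<phi> \<psi>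
      by (rule dual_eqI, simp_all add: cl that)
        (simp add: ev cl that H.R.a_assoc)
    show "\<theta> \<oplus>\<^bsub>dual R H\<^esub> \<phi> = \<phi> \<oplus>\<^bsub>dual R H\<^esub> \<theta>" if "\<theta> \<in> carrier (dual R H)" "\<phi> \<in> carrier (dual R H)" for \<theta> \<phi>
      by (rule dual_eqI, simp_all add: cl that)
        (simp add: ev cl that H.R.a_comm)
    show "\<zero>\<^bsub>dual R H\<^esub> \<oplus>\<^bsub>dual R H\<^esub> \<theta> = \<theta>" if "\<theta> \<in> carrier (dual R H)" for \<theta>
      by (rule dual_eqI, simp_all add: cl that)
        (simp add: ev cl that )
  qed (use cl in auto)
  show "c \<odot>\<^bsub>dual R H\<^esub> \<theta> \<in> carrier (dual R H)" if "c \<in> carrier R" "\<theta> \<in> carrier (dual R H)" for c \<theta>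
    using that by (rule smult)
  show "(c \<oplus> d) \<odot>\<^bsub>dual R H\<^esub> \<theta> = c \<odot>\<^bsub>dual R H\<^esub> \<theta> \<oplus>\<^bsub>dual R H\<^esub> d \<odot>\<^bsub>dual R H\<^esub> \<theta>"
    if "c \<in> carrier R" "d \<in> carrier R" "\<theta> \<in> carrier (dual R H)" for c d \<theta>
    by (rule dual_eqI, simp_all add: cl that) (simp add: ev cl that H.R.l_distr)
  show "c \<odot>\<^bsub>dual R H\<^esub> (\<theta> \<oplus>\<^bsub>dual R H\<^esub> \<phi>) = c \<odot>\<^bsub>dual R H\<^esub> \<theta> \<oplus>\<^bsub>dual R H\<^esub> c \<odot>\<^bsub>dual R H\<^esub> \<phi>"
    if "c \<in> carrier R" "\<theta> \<in> carrier (dual R H)" "\<phi> \<in> carrier (dual R H)" for c \<theta> \<phi>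
    by (rule dual_eqI, simp_all add: cl that) (simp add: ev cl that H.R.r_distr)
  show "(c \<otimes> d) \<odot>\<^bsub>dual R H\<^esub> \<theta> = c \<odot>\<^bsub>dual R H\<^esub> (d \<odot>\<^bsub>dual R H\<^esub> \<theta>)"
    if "c \<in> carrier R" "d \<in> carrier R" "\<theta> \<in> carrier (dual R H)" for c d \<theta>
    by (rule dual_eqI, simp_all add: cl that) (simp add: ev cl that H.R.m_assoc)
  show "\<one> \<odot>\<^bsub>dual R H\<^esub> \<theta> = \<theta>" if "\<theta> \<in> carrier (dual R H)" for \<theta>
    by (rule dual_eqI, simp_all add: cl that) (simp add: ev cl that)
qed

context hopf_algebra
begin

lemmas dual_closed = dual_closed[where R = R and H = H]
lemmas dual_eqI = dual_eqI[where R = R and H = H]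

abbreviation "D \<equiv> dual R H"
abbreviation "k \<equiv> base_algebra R"
abbreviation "\<Delta> \<equiv> comult H"
abbreviation "\<epsilon> \<equiv> counit H"

lemma alg_H: "unital_algebra R H"
  by (rule unital_algebra_axioms)

lemma mod_k: "module R k"
  by (rule base_module)

lemma mod_H: "module R H"
  by (rule module_axioms)

lemma comult_lin: "\<Delta> \<in> lin_map R H (tensor R H H)"
  and counit_lin: "\<epsilon> \<in> lin_map R H k"
  using comult_hom counit_hom by (auto simp: alg_hom_def)

lemma comult_closed: "h \<in> carrier H \<Longrightarrow> \<Delta> h \<in> carrier (tensor R H H)"
  using lin_map_closed[OF comult_lin] .

lemma counit_closed: "h \<in> carrier H \<Longrightarrow> \<epsilon> h \<in> carrier R"
  using lin_map_closed[OF counit_lin] by simp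

lemma dual_apply_lin: "\<lbrakk>\<theta> \<in> carrier D; f \<in> lin_map R Q H\<rbrakk> \<Longrightarrow> (\<lambda>x. \<theta> (f x)) \<in> lin_map R Q k"
  by (rule lin_map_comp[OF _ dual_lin])

lemma dual_eval_lin: "h \<in> carrier H \<Longrightarrow> (\<lambda>\<theta>. \<theta> h) \<in> lin_map R D k"
  by (rule lin_mapI) (auto simp: dual_simps(4-6) dual_closed)

lemmas hopf_lin = lin_intros dual_apply_lin dual_eval_lin

lemmas hopf_mod = mod_k mod_H dual_module[OF mod_H] cring_axioms alg_H

lemma conv_bilin: "\<lbrakk>\<theta> \<in> carrier D; \<phi> \<in> carrier D\<rbrakk> \<Longrightarrow> (\<lambda>a b. \<theta> a \<otimes> \<phi> b) \<in> bilin R H H k"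
  by (intro hopf_lin hopf_mod dual_closed; assumption)

lemma conv_lin: "\<lbrakk>\<theta> \<in> carrier D; \<phi> \<in> carrier D\<rbrakk> \<Longrightarrow>
    (\<lambda>h. tlift R H H k (\<lambda>a b. \<theta> a \<otimes> \<phi> b) (\<Delta> h)) \<in> lin_map R H k"
  by (intro tlift_comp_lin conv_bilin comult_lin hopf_mod)

lemma dual_mult_closed: "\<lbrakk>\<theta> \<in> carrier D; \<phi> \<in> carrier D\<rbrakk> \<Longrightarrow> \<theta> \<otimes>\<^bsub>D\<^esub> \<phi> \<in> carrier D"
  unfolding dual_simps(2) by (intro restrict_dual[OF mod_H] conv_lin)

lemma dual_mult_apply: "h \<in> carrier H \<Longrightarrow>
    (\<theta> \<otimes>\<^bsub>D\<^esub> \<phi>) h = tlift R H H k (\<lambda>a b. \<theta> a \<otimes> \<phi> b) (\<Delta> h)"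
  by (simp add: dual_simps)

lemma dual_one_closed: "\<one>\<^bsub>D\<^esub> \<in> carrier D"
  unfolding dual_simps(3) by (intro restrict_dual[OF mod_H] counit_lin)

text \<open>
  Coassociativity of \<open>H\<close> evaluated under the functional \<open>T = \<theta> \<otimes> (\<phi> \<otimes> \<psi>)\<close> on \<open>H \<otimes> (H \<otimes> H)\<close>.
\<close>

lemma dual_mult_assoc:
  assumes D: "\<theta> \<in> carrier D" "\<phi> \<in> carrier D" "\<psi> \<in> carrier D"
  shows "(\<theta> \<otimes>\<^bsub>D\<^esub> \<phi>) \<otimes>\<^bsub>D\<^esub> \<psi> = \<theta> \<otimes>\<^bsub>D\<^esub> (\<phi> \<otimes>\<^bsub>D\<^esub> \<psi>)"
proof (rule dual_eqI)
  fix h assume h: "h \<in> carrier H"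
  let ?HH = "tensor R H H"
  let ?c = "\<lambda>a u. \<theta> a \<otimes> tlift R H H k (\<lambda>b c. \<phi> b \<otimes> \<psi> c) u"
  define T where "T = tlift R H ?HH k ?c"
  note mods = hopf_mod tensor_module[OF mod_H mod_H] tensor_module[OF mod_H tensor_module[OF mod_H mod_H]]
    tensor_module[OF tensor_module[OF mod_H mod_H] mod_H]
  have inner: "tlift R H H k (\<lambda>b c. \<phi> b \<otimes> \<psi> c) u \<in> carrier R" if "u \<in> carrier ?HH" for u
    using tlift_closed[OF mod_H mod_H mod_k conv_bilin[OF D(2,3)] that] by simp
  have c: "?c \<in> bilin R H ?HH k"
    by (intro hopf_lin mods conv_bilin D inner dual_closed; assumption)
  have T: "T \<in> lin_map R (tensor R H ?HH) k"
    unfolding T_def by (rule tlift_lin[OF _ _ _ c]) (intro mods)+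
  have T_tens: "T (tens R H ?HH a u) = ?c a u" if "a \<in> carrier H" "u \<in> carrier ?HH" for a u
    unfolding T_def by (rule tlift_tens[OF _ _ _ c that]) (intro mods)+
  \<comment> \<open>The functional \<open>T\<close> on the two sides of coassociativity.\<close>
  have right: "T (tens_map R H H H ?HH (\<lambda>g. g) \<Delta> t) =
      tlift R H H k (\<lambda>a b. \<theta> a \<otimes> (\<phi> \<otimes>\<^bsub>D\<^esub> \<psi>) b) t" if t: "t \<in> carrier ?HH" for t
  proof (rule tensor_eqI[OF mod_H mod_H mod_k _ _ _ t])
    show "(\<lambda>t. T (tens_map R H H H ?HH (\<lambda>g. g) \<Delta> t)) \<in> lin_map R ?HH k"
      by (intro lin_map_comp[OF tens_map_lin T] lin_map_id comult_lin mods)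
    show "tlift R H H k (\<lambda>a b. \<theta> a \<otimes> (\<phi> \<otimes>\<^bsub>D\<^esub> \<psi>) b) \<in> lin_map R ?HH k"
      by (intro tlift_lin conv_bilin mods dual_mult_closed D)
    show "T (tens_map R H H H ?HH (\<lambda>g. g) \<Delta> (tens R H H a b)) =
        tlift R H H k (\<lambda>a b. \<theta> a \<otimes> (\<phi> \<otimes>\<^bsub>D\<^esub> \<psi>) b) (tens R H H a b)"
      if "a \<in> carrier H" "b \<in> carrier H" for a b
      using that by (simp add: tens_map_tens lin_map_id comult_lin mods T_tens comult_closed
        tlift_tens conv_bilin dual_mult_closed D dual_mult_apply)
  qed
  have left: "T (tens_assoc R H H H (tens_map R H H ?HH H \<Delta> (\<lambda>g. g) t)) =
      tlift R H H k (\<lambda>a b. (\<theta> \<otimes>\<^bsub>D\<^esub> \<phi>) a \<otimes> \<psi> b) t" if t: "t \<in> carrier ?HH" for t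
  proof (rule tensor_eqI[OF mod_H mod_H mod_k _ _ _ t])
    show "(\<lambda>t. T (tens_assoc R H H H (tens_map R H H ?HH H \<Delta> (\<lambda>g. g) t))) \<in> lin_map R ?HH k"
      by (intro lin_map_comp[OF lin_map_comp[OF tens_map_lin tens_assoc_lin] T] lin_map_id comult_lin mods)
    show "tlift R H H k (\<lambda>a b. (\<theta> \<otimes>\<^bsub>D\<^esub> \<phi>) a \<otimes> \<psi> b) \<in> lin_map R ?HH k"
      by (intro tlift_lin conv_bilin mods dual_mult_closed D)
    fix a b assume ab: "a \<in> carrier H" "b \<in> carrier H"
    have bil: "(\<lambda>m n. tens R H ?HH m (tens R H H n b)) \<in> bilin R H H (tensor R H ?HH)"
      by (rule assoc_inner_bilin) (intro mods ab)+
    have lin_b: "(\<lambda>r. r \<otimes> \<psi> b) \<in> lin_map R k k"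
      by (intro hopf_lin mods dual_closed D ab)
    have "T (tens_assoc R H H H (tens_map R H H ?HH H \<Delta> (\<lambda>g. g) (tens R H H a b))) =
        T (tlift R H H (tensor R H ?HH) (\<lambda>m n. tens R H ?HH m (tens R H H n b)) (\<Delta> a))"
      using ab by (simp add: tens_map_tens lin_map_id comult_lin mods tens_assoc_tens comult_closed)
    also have "\<dots> = tlift R H H k (\<lambda>m n. T (tens R H ?HH m (tens R H H n b))) (\<Delta> a)"
      by (rule lin_tlift[OF _ _ _ _ bil T]) (intro mods comult_closed ab)+
    also have "\<dots> = tlift R H H k (\<lambda>m n. (\<theta> m \<otimes> \<phi> n) \<otimes> \<psi> b) (\<Delta> a)"
    proof (rule tlift_cong)
      show "(\<lambda>m n. (\<theta> m \<otimes> \<phi> n) \<otimes> \<psi> b) \<in> bilin R H H k"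
        by (rule bilin_comp[OF conv_bilin lin_b]) (intro D)+
      show "T (tens R H ?HH m (tens R H H n b)) = (\<theta> m \<otimes> \<phi> n) \<otimes> \<psi> b"
        if "m \<in> carrier H" "n \<in> carrier H" for m n
        using that ab D
        by (simp add: T_tens mods tlift_tens conv_bilin dual_closed m_assoc)
    qed (intro mods comult_closed ab)+
    also have "\<dots> = tlift R H H k (\<lambda>m n. \<theta> m \<otimes> \<phi> n) (\<Delta> a) \<otimes> \<psi> b"
      by (rule lin_tlift[OF _ _ _ _ conv_bilin lin_b, symmetric]) (intro mods comult_closed ab D)+
    also have "\<dots> = (\<theta> \<otimes>\<^bsub>D\<^esub> \<phi>) a \<otimes> \<psi> b"
      using ab by (simp add: dual_mult_apply)
    also have "\<dots> = tlift R H H k (\<lambda>a b. (\<theta> \<otimes>\<^bsub>D\<^esub> \<phi>) a \<otimes> \<psi> b) (tens R H H a b)"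
      using ab D by (simp add: tlift_tens mods conv_bilin dual_mult_closed)
    finally show "T (tens_assoc R H H H (tens_map R H H ?HH H \<Delta> (\<lambda>g. g) (tens R H H a b))) = \<dots>" .
  qed
  show "((\<theta> \<otimes>\<^bsub>D\<^esub> \<phi>) \<otimes>\<^bsub>D\<^esub> \<psi>) h = (\<theta> \<otimes>\<^bsub>D\<^esub> (\<phi> \<otimes>\<^bsub>D\<^esub> \<psi>)) h"
    using left[OF comult_closed[OF h]] right[OF comult_closed[OF h]] coassoc[OF h] h
    by (simp add: dual_mult_apply)
qed (intro dual_mult_closed D)+

lemma dual_one_mult:
  assumes \<theta>: "\<theta> \<in> carrier D"
  shows "\<one>\<^bsub>D\<^esub> \<otimes>\<^bsub>D\<^esub> \<theta> = \<theta>" "\<theta> \<otimes>\<^bsub>D\<^esub> \<one>\<^bsub>D\<^esub> = \<theta>"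
proof -
  have lin: "(\<lambda>x. \<epsilon> (f x)) \<in> lin_map R Q k" if "f \<in> lin_map R Q H" for f Q
    by (rule lin_map_comp[OF that counit_lin])
  have bl: "(\<lambda>a b. \<epsilon> a \<odot>\<^bsub>H\<^esub> b) \<in> bilin R H H H" "(\<lambda>a b. \<epsilon> b \<odot>\<^bsub>H\<^esub> a) \<in> bilin R H H H"
    by (intro hopf_lin lin hopf_mod counit_closed; assumption)+
  show "\<one>\<^bsub>D\<^esub> \<otimes>\<^bsub>D\<^esub> \<theta> = \<theta>"
  proof (rule dual_eqI)
    fix h assume h: "h \<in> carrier H"
    have "(\<one>\<^bsub>D\<^esub> \<otimes>\<^bsub>D\<^esub> \<theta>) h = tlift R H H k (\<lambda>a b. \<one>\<^bsub>D\<^esub> a \<otimes> \<theta> b) (\<Delta> h)"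
      using h by (rule dual_mult_apply)
    also have "\<dots> = tlift R H H k (\<lambda>a b. \<theta> (\<epsilon> a \<odot>\<^bsub>H\<^esub> b)) (\<Delta> h)"
      by (rule tlift_cong[OF mod_H mod_H comult_closed[OF h] _ mod_k bilin_comp[OF bl(1) dual_lin[OF \<theta>]]])
        (simp add: dual_simps(3) lin_map_smult[OF dual_lin[OF \<theta>]] counit_closed)
    also have "\<dots> = \<theta> h"
      using lin_tlift[OF mod_H mod_H mod_H mod_k bl(1) dual_lin[OF \<theta>] comult_closed[OF h]] counit_left[OF h]
      by simp
    finally show "(\<one>\<^bsub>D\<^esub> \<otimes>\<^bsub>D\<^esub> \<theta>) h = \<theta> h" .
  qed (intro dual_mult_closed dual_one_closed \<theta>)+
  show "\<theta> \<otimes>\<^bsub>D\<^esub> \<one>\<^bsub>D\<^esub> = \<theta>"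
  proof (rule dual_eqI)
    fix h assume h: "h \<in> carrier H"
    have "(\<theta> \<otimes>\<^bsub>D\<^esub> \<one>\<^bsub>D\<^esub>) h = tlift R H H k (\<lambda>a b. \<theta> a \<otimes> \<one>\<^bsub>D\<^esub> b) (\<Delta> h)"
      using h by (rule dual_mult_apply)
    also have "\<dots> = tlift R H H k (\<lambda>a b. \<theta> (\<epsilon> b \<odot>\<^bsub>H\<^esub> a)) (\<Delta> h)"
      by (rule tlift_cong[OF mod_H mod_H comult_closed[OF h] _ mod_k bilin_comp[OF bl(2) dual_lin[OF \<theta>]]])
        (simp add: dual_simps(3) lin_map_smult[OF dual_lin[OF \<theta>]] counit_closed dual_closed \<theta> m_comm)
    also have "\<dots> = \<theta> h"
      using lin_tlift[OF mod_H mod_H mod_H mod_k bl(2) dual_lin[OF \<theta>] comult_closed[OF h]] counit_right[OF h]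
      by simp
    finally show "(\<theta> \<otimes>\<^bsub>D\<^esub> \<one>\<^bsub>D\<^esub>) h = \<theta> h" .
  qed (intro dual_mult_closed dual_one_closed \<theta>)+
qed

lemma dual_mult_bilin: "(\<lambda>\<theta> \<phi>. \<theta> \<otimes>\<^bsub>D\<^esub> \<phi>) \<in> bilin R D D D"
proof -
  have l: "(\<lambda>\<theta>. (\<theta> \<otimes>\<^bsub>D\<^esub> \<phi>) h) \<in> lin_map R D k" if "h \<in> carrier H" "\<phi> \<in> carrier D" for h \<phi>
    unfolding dual_mult_apply[OF that(1)]
    by (intro hopf_lin hopf_mod comult_closed dual_closed that; assumption)
  have r: "(\<lambda>\<phi>. (\<theta> \<otimes>\<^bsub>D\<^esub> \<phi>) h) \<in> lin_map R D k" if "h \<in> carrier H" "\<theta> \<in> carrier D" for h \<theta>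
    unfolding dual_mult_apply[OF that(1)]
    by (intro hopf_lin hopf_mod comult_closed dual_closed that; assumption)
  interpret D: module R D by (rule dual_module[OF mod_H])
  have apply_simps: "(\<theta> \<oplus>\<^bsub>D\<^esub> \<phi>) h = \<theta> h \<oplus> \<phi> h" "(c \<odot>\<^bsub>D\<^esub> \<theta>) h = c \<otimes> \<theta> h"
    if "h \<in> carrier H" for \<theta> \<phi> c h
    using that by (simp_all add: dual_simps)
  show ?thesis
    by (intro bilinI lin_mapI; (rule dual_eqI)?)
      (simp_all add: dual_mult_closed apply_simps lin_map_add[OF l] lin_map_add[OF r]
        lin_map_smult[OF l] lin_map_smult[OF r])
qed

lemma dual_unital_algebra: "unital_algebra R D"
proof (intro unital_algebra.intro ringI unital_algebra_axioms.intro monoidI)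
  interpret D: module R D by (rule dual_module[OF mod_H])
  show "module R D" "abelian_group D" by (rule dual_module[OF mod_H], rule D.abelian_group_axioms)
qed (use lin_map_add[OF bilin_left[OF dual_mult_bilin]] lin_map_add[OF bilin_right[OF dual_mult_bilin]]
    lin_map_smult[OF bilin_left[OF dual_mult_bilin]] lin_map_smult[OF bilin_right[OF dual_mult_bilin]] in
    \<open>auto simp: dual_one_closed dual_one_mult dual_mult_closed dual_mult_assoc\<close>)

end


section \<open>Pairing with the first leg\<close>

text \<open>
  The map \<open>D \<otimes> N \<rightarrow> N\<close>, \<open>\<theta> \<otimes> n \<mapsto> \<theta>(h) n\<close>. For finite-dimensional \<open>H\<close>, reading it
  as a function of \<open>h\<close> identifies tensors with linear maps from \<open>H\<close> to \<open>N\<close>; the action induced by a coaction \<open>\<beta>\<close> is the pairing with \<open>\<beta> x\<close>.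
\<close>

definition pairing ::
  "('k, 'r) ring_scheme \<Rightarrow> ('k, 'h, 'a) hopf_algebra_scheme \<Rightarrow> ('k, 'n, 'b) module_scheme
    \<Rightarrow> 'h \<Rightarrow> ('k, 'h \<Rightarrow> 'k, 'n) tensor \<Rightarrow> 'n"
where
  "pairing R H N h = tlift R (dual R H) N N (\<lambda>\<theta> n. \<theta> h \<odot>\<^bsub>N\<^esub> n)"

lemma induced_action_pairing: "induced_action R H X \<beta> x h = pairing R H X h (\<beta> x)"
  by (simp add: induced_action_def pairing_def)

context hopf_algebra
begin

abbreviation "ev \<equiv> pairing R H"

lemma mod_D: "module R D"
  by (rule dual_module[OF mod_H])

lemma pairing_bilin:
  assumes "module R N" "h \<in> carrier H"
  shows "(\<lambda>\<theta> n. \<theta> h \<odot>\<^bsub>N\<^esub> n) \<in> bilin R D N N"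
  by (intro hopf_lin hopf_mod dual_closed assms)

lemma pairing_lin: "\<lbrakk>module R N; h \<in> carrier H\<rbrakk> \<Longrightarrow> ev N h \<in> lin_map R (tensor R D N) N"
  unfolding pairing_def by (intro tlift_lin pairing_bilin mod_D)

lemma pairing_closed: "\<lbrakk>module R N; h \<in> carrier H; t \<in> carrier (tensor R D N)\<rbrakk> \<Longrightarrow> ev N h t \<in> carrier N"
  using lin_map_closed[OF pairing_lin] .

lemma pairing_tens:
  "\<lbrakk>module R N; h \<in> carrier H; \<theta> \<in> carrier D; n \<in> carrier N\<rbrakk> \<Longrightarrow>
    ev N h (tens R D N \<theta> n) = \<theta> h \<odot>\<^bsub>N\<^esub> n"
  unfolding pairing_def
  by (intro tlift_tens[where b = "\<lambda>\<theta> n. \<theta> h \<odot>\<^bsub>N\<^esub> n"] pairing_bilin mod_D)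

lemma pairing_lin_arg:
  assumes N: "module R N" and t: "t \<in> carrier (tensor R D N)"
  shows "(\<lambda>h. ev N h t) \<in> lin_map R H N"
  unfolding pairing_def
proof (rule tlift_param_lin[OF mod_H mod_D N N t])
  show "(\<lambda>\<theta> n. \<theta> h \<odot>\<^bsub>N\<^esub> n) \<in> bilin R D N N" if "h \<in> carrier H" for h
    using N that by (rule pairing_bilin)
  show "(\<lambda>h. \<theta> h \<odot>\<^bsub>N\<^esub> n) \<in> lin_map R H N" if "\<theta> \<in> carrier D" "n \<in> carrier N" for \<theta> n
    by (intro smult_lin_left dual_lin N that)
qed

lemma pairing_map:
  assumes N: "module R N" and P: "module R P" and f: "f \<in> lin_map R N P" and h: "h \<in> carrier H"
    and t: "t \<in> carrier (tensor R D N)"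
  shows "ev P h (tens_map R D N D P (\<lambda>\<theta>. \<theta>) f t) = f (ev N h t)"
proof (rule tensor_eqI[OF mod_D N P _ _ _ t])
  show "(\<lambda>t. ev P h (tens_map R D N D P (\<lambda>\<theta>. \<theta>) f t)) \<in> lin_map R (tensor R D N) P"
    by (intro lin_map_comp[OF tens_map_lin pairing_lin] mod_D N P lin_map_id f h)
  show "(\<lambda>t. f (ev N h t)) \<in> lin_map R (tensor R D N) P"
    by (rule lin_map_comp[OF pairing_lin f]) (intro N h)+
qed (simp add: tens_map_tens mod_D N P lin_map_id f pairing_tens h lin_map_closed[OF f]
    lin_map_smult[OF f] dual_closed)

lemma conv_pairing_bilin:
  assumes A: "unital_algebra R A"
    and s: "s \<in> carrier (tensor R D A)" and t: "t \<in> carrier (tensor R D A)"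
  shows "(\<lambda>a b. ev A a s \<otimes>\<^bsub>A\<^esub> ev A b t) \<in> bilin R H H A"
proof -
  note M = unital_algebra_module[OF A]
  show ?thesis
    by (intro bilinI mult_lin_left mult_lin_right A pairing_lin_arg pairing_closed M s t)
qed

text \<open>
  On elementary tensors this is the definition of the product in \<open>D\<close>:
  \<open>(\<theta>\<phi>)(h) xy = \<theta>(h\<^sub>1) x \<phi>(h\<^sub>2) y\<close>.
\<close>

lemma pairing_mult:
  assumes A: "unital_algebra R A" and h: "h \<in> carrier H"
    and s: "s \<in> carrier (tensor R D A)" and t: "t \<in> carrier (tensor R D A)"
  shows "ev A h (s \<otimes>\<^bsub>tensor R D A\<^esub> t) = tlift R H H A (\<lambda>a b. ev A a s \<otimes>\<^bsub>A\<^esub> ev A b t) (\<Delta> h)"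
proof -
  note M = unital_algebra_module[OF A]
  note DA = unital_algebra_tensor[OF dual_unital_algebra A]
  interpret A: unital_algebra R A by (rule A)
  let ?DA = "tensor R D A"
  have lin_l: "(\<lambda>s. tlift R H H A (\<lambda>a b. ev A a s \<otimes>\<^bsub>A\<^esub> ev A b t) (\<Delta> h)) \<in> lin_map R ?DA A"
    if "t \<in> carrier ?DA" for t
    by (intro tlift_param_lin tensor_module mult_lin_left pairing_lin conv_pairing_bilin pairing_closed
        comult_closed mod_D mod_H M A that h)
  have lin_r: "(\<lambda>t. tlift R H H A (\<lambda>a b. ev A a s \<otimes>\<^bsub>A\<^esub> ev A b t) (\<Delta> h)) \<in> lin_map R ?DA A"
    if "s \<in> carrier ?DA" for s
    by (intro tlift_param_lin tensor_module mult_lin_right pairing_lin conv_pairing_bilin pairing_closed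
        comult_closed mod_D mod_H M A that h)
  show ?thesis
  proof (rule tensor_eqI[where t = s, OF mod_D M M _ lin_l[OF t] _ s])
    show "(\<lambda>s. ev A h (s \<otimes>\<^bsub>?DA\<^esub> t)) \<in> lin_map R ?DA A"
      by (intro lin_map_comp[OF mult_lin_left pairing_lin] lin_map_id DA M h t)
    fix \<theta> x assume \<theta>: "\<theta> \<in> carrier D" and x: "x \<in> carrier A"
    note \<theta>x = tens_closed[OF mod_D M \<theta> x]
    show "ev A h (tens R D A \<theta> x \<otimes>\<^bsub>?DA\<^esub> t) =
        tlift R H H A (\<lambda>a b. ev A a (tens R D A \<theta> x) \<otimes>\<^bsub>A\<^esub> ev A b t) (\<Delta> h)"
    proof (rule tensor_eqI[where t = t, OF mod_D M M _ lin_r[OF \<theta>x] _ t])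
      show "(\<lambda>t. ev A h (tens R D A \<theta> x \<otimes>\<^bsub>?DA\<^esub> t)) \<in> lin_map R ?DA A"
        by (intro lin_map_comp[OF mult_lin_right pairing_lin] lin_map_id DA M h \<theta>x)
      fix \<phi> y assume \<phi>: "\<phi> \<in> carrier D" and y: "y \<in> carrier A"
      have xy: "x \<otimes>\<^bsub>A\<^esub> y \<in> carrier A" using x y by simp
      have lin: "(\<lambda>r. r \<odot>\<^bsub>A\<^esub> (x \<otimes>\<^bsub>A\<^esub> y)) \<in> lin_map R k A"
        by (intro smult_lin_left M lin_map_id xy)
      have "ev A h (tens R D A \<theta> x \<otimes>\<^bsub>?DA\<^esub> tens R D A \<phi> y) =
          tlift R H H k (\<lambda>a b. \<theta> a \<otimes> \<phi> b) (\<Delta> h) \<odot>\<^bsub>A\<^esub> (x \<otimes>\<^bsub>A\<^esub> y)"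
        using \<theta> \<phi> x y h
        by (simp add: tens_mult dual_unital_algebra A pairing_tens M dual_mult_closed dual_mult_apply)
      also have "\<dots> = tlift R H H A (\<lambda>a b. (\<theta> a \<otimes> \<phi> b) \<odot>\<^bsub>A\<^esub> (x \<otimes>\<^bsub>A\<^esub> y)) (\<Delta> h)"
        by (rule lin_tlift[OF mod_H mod_H mod_k M conv_bilin[OF \<theta> \<phi>] lin comult_closed[OF h]])
      also have "\<dots> = tlift R H H A (\<lambda>a b. ev A a (tens R D A \<theta> x) \<otimes>\<^bsub>A\<^esub> ev A b (tens R D A \<phi> y)) (\<Delta> h)"
      proof (rule tlift_cong[OF mod_H mod_H comult_closed[OF h] _ M])
        show "(\<lambda>a b. ev A a (tens R D A \<theta> x) \<otimes>\<^bsub>A\<^esub> ev A b (tens R D A \<phi> y)) \<in> bilin R H H A"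
          by (intro conv_pairing_bilin A tens_closed mod_D M \<theta> \<phi> x y)
        show "(\<theta> a \<otimes> \<phi> b) \<odot>\<^bsub>A\<^esub> (x \<otimes>\<^bsub>A\<^esub> y) =
            ev A a (tens R D A \<theta> x) \<otimes>\<^bsub>A\<^esub> ev A b (tens R D A \<phi> y)"
          if "a \<in> carrier H" "b \<in> carrier H" for a b
          using that \<theta> \<phi> x y
          by (simp add: pairing_tens M dual_closed A.smult_mult_left A.smult_mult_right
              A.smult_assoc1[symmetric] m_comm)
      qed
      finally show "ev A h (tens R D A \<theta> x \<otimes>\<^bsub>?DA\<^esub> tens R D A \<phi> y) = \<dots>" .
    qed
  qed
qed

lemma pairing_one:
  assumes "unital_algebra R A" "h \<in> carrier H"
  shows "ev A h \<one>\<^bsub>tensor R D A\<^esub> = \<epsilon> h \<odot>\<^bsub>A\<^esub> \<one>\<^bsub>A\<^esub>"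
proof -
  interpret A: unital_algebra R A by fact
  show ?thesis
    using assms(2) by (simp add: tensor_simps pairing_tens A.module_axioms dual_one_closed)
      (simp add: dual_simps)
qed

text \<open>
  Rebracketing leaves the first leg in place, so pairing with it acts on \<open>t\<close> alone.
\<close>

lemma pairing_assoc:
  assumes N: "module R N" and P: "module R P" and h: "h \<in> carrier H"
    and t: "t \<in> carrier (tensor R D N)" and p: "p \<in> carrier P"
  shows "ev (tensor R N P) h (tens_assoc R D N P (tens R (tensor R D N) P t p)) = tens R N P (ev N h t) p"
proof -
  let ?b = "\<lambda>\<theta> n. tens R D (tensor R N P) \<theta> (tens R N P n p)"
  have "ev (tensor R N P) h (tens_assoc R D N P (tens R (tensor R D N) P t p)) =
      ev (tensor R N P) h (tlift R D N (tensor R D (tensor R N P)) ?b t)"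
    using N P t p by (simp add: tens_assoc_tens mod_D)
  also have "\<dots> = tens R N P (ev N h t) p"
  proof (rule tensor_eqI[OF mod_D N tensor_module[OF N P] _ _ _ t])
    have bil: "?b \<in> bilin R D N (tensor R D (tensor R N P))"
      by (rule assoc_inner_bilin[OF mod_D N P p])
    show "(\<lambda>t. ev (tensor R N P) h (tlift R D N (tensor R D (tensor R N P)) ?b t))
        \<in> lin_map R (tensor R D N) (tensor R N P)"
      by (intro lin_map_comp[OF tlift_lin pairing_lin] bil tensor_module mod_D N P h)
    show "(\<lambda>t. tens R N P (ev N h t) p) \<in> lin_map R (tensor R D N) (tensor R N P)"
      by (intro tens_lin_left pairing_lin N P h p)
    fix \<theta> n assume \<theta>: "\<theta> \<in> carrier D" and n: "n \<in> carrier N"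
    have "(\<theta> h) \<odot>\<^bsub>tensor R N P\<^esub> tens R N P n p = tens R N P (\<theta> h \<odot>\<^bsub>N\<^esub> n) p"
      using lin_map_smult[OF bilin_left[OF tens_bilin[OF N P] p] dual_closed[OF \<theta> h] n] by simp
    then show "ev (tensor R N P) h (tlift R D N (tensor R D (tensor R N P)) ?b (tens R D N \<theta> n)) =
        tens R N P (ev N h (tens R D N \<theta> n)) p"
      using \<theta> n N P h p by (simp add: tlift_tens[OF _ _ _ bil] mod_D pairing_tens)
  qed
  finally show ?thesis .
qed

lemma pairing_leg13:
  assumes N: "unital_algebra R N" and P: "module R P" and h: "h \<in> carrier H"
    and v: "v \<in> carrier (tensor R D P)"
  shows "ev (tensor R N P) h (leg13 R D N P v) = tens R N P \<one>\<^bsub>N\<^esub> (ev P h v)"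
proof -
  interpret N: unital_algebra R N by fact
  note M = N.module_axioms
  note one = N.A.one_closed
  show ?thesis
  proof (rule tensor_eqI[OF mod_D P tensor_module[OF M P] _ _ _ v])
    show "(\<lambda>v. ev (tensor R N P) h (leg13 R D N P v)) \<in> lin_map R (tensor R D P) (tensor R N P)"
      by (intro lin_map_comp[OF leg13_lin pairing_lin] tensor_module mod_D M P h one)
    show "(\<lambda>v. tens R N P \<one>\<^bsub>N\<^esub> (ev P h v)) \<in> lin_map R (tensor R D P) (tensor R N P)"
      by (intro tens_lin_right pairing_lin M P h one)
    fix \<theta> p assume \<theta>: "\<theta> \<in> carrier D" and p: "p \<in> carrier P"
    have "(\<theta> h) \<odot>\<^bsub>tensor R N P\<^esub> tens R N P \<one>\<^bsub>N\<^esub> p = tens R N P \<one>\<^bsub>N\<^esub> (\<theta> h \<odot>\<^bsub>P\<^esub> p)"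
      using lin_map_smult[OF bilin_right[OF tens_bilin[OF M P] one] dual_closed[OF \<theta> h] p] by simp
    then show "ev (tensor R N P) h (leg13 R D N P (tens R D P \<theta> p)) =
        tens R N P \<one>\<^bsub>N\<^esub> (ev P h (tens R D P \<theta> p))"
      using \<theta> p M P h by (simp add: leg13_tens mod_D one pairing_tens)
  qed
qed

end


section \<open>Dual bases\<close>

lemma lin_map_finsum_pointwise:
  assumes P: "module R P" and f: "\<And>i. i \<in> I \<Longrightarrow> f i \<in> lin_map R M P"
  shows "(\<lambda>x. \<Oplus>\<^bsub>P\<^esub>i\<in>I. f i x) \<in> lin_map R M P"
proof (cases "finite I")
  case True
  interpret P: module R P by (rule P)
  have cl: "(\<lambda>i. f i x) \<in> I \<rightarrow> carrier P" if "x \<in> carrier M" for x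
    using lin_map_closed[OF f that] by auto
  show ?thesis
  proof (rule lin_mapI)
    show "(\<Oplus>\<^bsub>P\<^esub>i\<in>I. f i x) \<in> carrier P" if "x \<in> carrier M" for x
      using cl[OF that] by (rule P.finsum_closed)
    show "(\<Oplus>\<^bsub>P\<^esub>i\<in>I. f i (x \<oplus>\<^bsub>M\<^esub> y)) = (\<Oplus>\<^bsub>P\<^esub>i\<in>I. f i x) \<oplus>\<^bsub>P\<^esub> (\<Oplus>\<^bsub>P\<^esub>i\<in>I. f i y)"
      if "x \<in> carrier M" "y \<in> carrier M" for x y
      unfolding P.finsum_addf[OF cl[OF that(1)] cl[OF that(2)], symmetric]
      by (rule P.finsum_cong)
        (use cl that in \<open>auto simp: lin_map_add[OF f] simp_implies_def Pi_iff\<close>)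
    show "(\<Oplus>\<^bsub>P\<^esub>i\<in>I. f i (a \<odot>\<^bsub>M\<^esub> x)) = a \<odot>\<^bsub>P\<^esub> (\<Oplus>\<^bsub>P\<^esub>i\<in>I. f i x)"
      if "a \<in> carrier R" "x \<in> carrier M" for a x
      unfolding P.finsum_smult_ldistr[OF True that(1) cl[OF that(2)]]
      by (rule P.finsum_cong)
        (use cl that in \<open>auto simp: lin_map_smult[OF f] simp_implies_def Pi_iff\<close>)
  qed
next
  case False
  interpret P: module R P by (rule P)
  show ?thesis using False by (intro lin_mapI) (simp_all add: P.finsum_infinite)
qed

locale fin_dim_hopf_algebra = hopf_algebra +
  assumes fin_dim: "finite_dimensional R H"
begin

definition "B = (SOME B. finite_basis R H B)"

lemma basis: "finite_basis R H B"
  using fin_dim unfolding B_def finite_dimensional_def by (rule someI_ex)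

lemma finite_B: "finite B" and B_closed: "b \<in> B \<Longrightarrow> b \<in> carrier H"
  using basis by (auto simp: finite_basis_def)

text \<open>
  Coordinates with respect to \<open>B\<close>; they depend linearly on \<open>x\<close> because they are unique.
\<close>

definition "is_coord x c \<longleftrightarrow> c \<in> B \<rightarrow>\<^sub>E carrier R \<and> x = (\<Oplus>\<^bsub>H\<^esub>b\<in>B. c b \<odot>\<^bsub>H\<^esub> b)"
definition "coord x = (THE c. is_coord x c)"

lemma ex1_coord: "x \<in> carrier H \<Longrightarrow> \<exists>!c. is_coord x c"
  using basis unfolding finite_basis_def is_coord_def by (elim conjE) (drule (1) bspec)

lemma is_coord_coord: "x \<in> carrier H \<Longrightarrow> is_coord x (coord x)"
  unfolding coord_def by (rule theI'[OF ex1_coord])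

lemma coordI: "\<lbrakk>x \<in> carrier H; is_coord x c\<rbrakk> \<Longrightarrow> coord x = c"
  unfolding coord_def by (rule the1_equality[OF ex1_coord])

lemma coord_closed: "\<lbrakk>x \<in> carrier H; b \<in> B\<rbrakk> \<Longrightarrow> coord x b \<in> carrier R"
  using is_coord_coord[of x] by (auto simp: is_coord_def)

lemma coord_term_closed: "x \<in> carrier H \<Longrightarrow> (\<lambda>b. coord x b \<odot>\<^bsub>H\<^esub> b) \<in> B \<rightarrow> carrier H"
  using coord_closed B_closed by auto

lemma coord_expand: "x \<in> carrier H \<Longrightarrow> (\<Oplus>\<^bsub>H\<^esub>b\<in>B. coord x b \<odot>\<^bsub>H\<^esub> b) = x"
  using is_coord_coord[of x] by (simp add: is_coord_def)

lemma coord_lin: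
  assumes b: "b \<in> B"
  shows "(\<lambda>x. coord x b) \<in> lin_map R H k"
proof (rule lin_mapI)
  fix x y assume x: "x \<in> carrier H" and y: "y \<in> carrier H"
  have "is_coord (x \<oplus>\<^bsub>H\<^esub> y) (\<lambda>b\<in>B. coord x b \<oplus> coord y b)"
    unfolding is_coord_def
  proof
    have "(\<Oplus>\<^bsub>H\<^esub>b\<in>B. (\<lambda>b\<in>B. coord x b \<oplus> coord y b) b \<odot>\<^bsub>H\<^esub> b) =
        (\<Oplus>\<^bsub>H\<^esub>b\<in>B. coord x b \<odot>\<^bsub>H\<^esub> b \<oplus>\<^bsub>H\<^esub> coord y b \<odot>\<^bsub>H\<^esub> b)"
      using x y by (intro M.finsum_cong)
        (auto simp: simp_implies_def smult_l_distr coord_closed B_closed)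
    also have "\<dots> = x \<oplus>\<^bsub>H\<^esub> y"
      using x y by (simp add: M.finsum_addf coord_term_closed coord_expand)
    finally show "x \<oplus>\<^bsub>H\<^esub> y = (\<Oplus>\<^bsub>H\<^esub>b\<in>B. (\<lambda>b\<in>B. coord x b \<oplus> coord y b) b \<odot>\<^bsub>H\<^esub> b)" by simp
  qed (use x y in \<open>auto simp: coord_closed\<close>)
  then show "coord (x \<oplus>\<^bsub>H\<^esub> y) b = coord x b \<oplus>\<^bsub>k\<^esub> coord y b"
    using x y b by (simp add: coordI)
next
  fix a x assume a: "a \<in> carrier R" and x: "x \<in> carrier H"
  have "is_coord (a \<odot>\<^bsub>H\<^esub> x) (\<lambda>b\<in>B. a \<otimes> coord x b)"
    unfolding is_coord_def
  proof
    have "(\<Oplus>\<^bsub>H\<^esub>b\<in>B. (\<lambda>b\<in>B. a \<otimes> coord x b) b \<odot>\<^bsub>H\<^esub> b) =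
        (\<Oplus>\<^bsub>H\<^esub>b\<in>B. a \<odot>\<^bsub>H\<^esub> (coord x b \<odot>\<^bsub>H\<^esub> b))"
      using a x by (intro M.finsum_cong)
        (auto simp: simp_implies_def smult_assoc1 coord_closed B_closed)
    also have "\<dots> = a \<odot>\<^bsub>H\<^esub> x"
      using a x finsum_smult_ldistr[OF finite_B a coord_term_closed[OF x]] by (simp add: coord_expand)
    finally show "a \<odot>\<^bsub>H\<^esub> x = (\<Oplus>\<^bsub>H\<^esub>b\<in>B. (\<lambda>b\<in>B. a \<otimes> coord x b) b \<odot>\<^bsub>H\<^esub> b)" by simp
  qed (use a x in \<open>auto simp: coord_closed\<close>)
  then show "coord (a \<odot>\<^bsub>H\<^esub> x) b = a \<odot>\<^bsub>k\<^esub> coord x b"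
    using a x b by (simp add: coordI)
qed (use b in \<open>simp add: coord_closed\<close>)

text \<open>
  The dual basis. In this form its linearity is inherited from that of the coordinates;
  \<open>dual_vec_dvec\<close> shows that these are the functionals that enter the canonical element.
\<close>

definition "dvec b = (\<lambda>h\<in>carrier H. coord h b)"

lemma dvec_closed: "b \<in> B \<Longrightarrow> dvec b \<in> carrier D"
  unfolding dvec_def by (intro restrict_dual[OF mod_H] coord_lin)

lemma dvec_apply: "h \<in> carrier H \<Longrightarrow> dvec b h = coord h b"
  by (simp add: dvec_def)

lemma dvec_basis:
  assumes "b \<in> B" "b' \<in> B"
  shows "dvec b b' = (if b' = b then \<one> else \<zero>)"
proof -
  let ?c = "\<lambda>b\<in>B. if b' = b then \<one> else \<zero>"
  have "(\<Oplus>\<^bsub>H\<^esub>b\<in>B. ?c b \<odot>\<^bsub>H\<^esub> b) = (\<Oplus>\<^bsub>H\<^esub>b\<in>B. if b' = b then b else \<zero>\<^bsub>H\<^esub>)"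
    by (intro M.finsum_cong) (auto simp: simp_implies_def B_closed)
  also have "\<dots> = b'"
    using M.finsum_singleton[OF assms(2) finite_B, of "\<lambda>b. b"] B_closed by auto
  finally have "is_coord b' ?c"
    by (auto simp: is_coord_def)
  then show ?thesis
    using assms B_closed by (simp add: dvec_apply coordI)
qed

lemma dual_apply_expand:
  assumes \<theta>: "\<theta> \<in> carrier D" and h: "h \<in> carrier H"
  shows "\<theta> h = (\<Oplus>\<^bsub>k\<^esub>b\<in>B. dvec b h \<otimes> \<theta> b)"
proof -
  interpret K: module R k by (rule mod_k)
  have "\<theta> h = \<theta> (\<Oplus>\<^bsub>H\<^esub>b\<in>B. coord h b \<odot>\<^bsub>H\<^esub> b)" using h by (simp add: coord_expand)
  also have "\<dots> = (\<Oplus>\<^bsub>k\<^esub>b\<in>B. \<theta> (coord h b \<odot>\<^bsub>H\<^esub> b))"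
    by (rule lin_map_finsum[OF mod_H mod_k dual_lin[OF \<theta>] finite_B coord_term_closed[OF h]])
  also have "\<dots> = (\<Oplus>\<^bsub>k\<^esub>b\<in>B. dvec b h \<otimes> \<theta> b)"
    using h \<theta> by (intro K.finsum_cong)
      (auto simp: simp_implies_def lin_map_smult[OF dual_lin[OF \<theta>]] coord_closed B_closed
        dvec_apply dual_closed)
  finally show ?thesis .
qed

lemma dual_vec_dvec:
  assumes b: "b \<in> B"
  shows "dual_vec R H B b = dvec b"
  unfolding dual_vec_def
proof (rule the_equality)
  show "dvec b \<in> carrier D \<and> (\<forall>b'\<in>B. dvec b b' = (if b' = b then \<one> else \<zero>))"
    using b by (simp add: dvec_closed dvec_basis)
  fix \<theta> assume \<theta>: "\<theta> \<in> carrier D \<and> (\<forall>b'\<in>B. \<theta> b' = (if b' = b then \<one> else \<zero>))"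
  interpret K: module R k by (rule mod_k)
  show "\<theta> = dvec b"
  proof (rule dual_eqI)
    fix h assume h: "h \<in> carrier H"
    have "\<theta> h = (\<Oplus>\<^bsub>k\<^esub>b\<in>B. dvec b h \<otimes> \<theta> b)" using \<theta> h by (intro dual_apply_expand) auto
    also have "\<dots> = (\<Oplus>\<^bsub>k\<^esub>b'\<in>B. dvec b' h \<otimes> dvec b b')"
      using \<theta> b h by (intro K.finsum_cong) (auto simp: simp_implies_def dvec_basis dual_closed dvec_closed)
    also have "\<dots> = dvec b h" using dual_apply_expand[OF dvec_closed[OF b] h] by simp
    finally show "\<theta> h = dvec b h" .
  qed (use \<theta> b dvec_closed in auto)
qed

lemma dual_expand:
  assumes \<theta>: "\<theta> \<in> carrier D"
  shows "(\<Oplus>\<^bsub>D\<^esub>b\<in>B. \<theta> b \<odot>\<^bsub>D\<^esub> dvec b) = \<theta>"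
proof -
  interpret K: module R k by (rule mod_k)
  interpret D: module R D by (rule mod_D)
  have cl: "(\<lambda>b. \<theta> b \<odot>\<^bsub>D\<^esub> dvec b) \<in> B \<rightarrow> carrier D"
    using \<theta> by (auto simp: dual_closed B_closed dvec_closed)
  show ?thesis
  proof (rule dual_eqI)
    fix h assume h: "h \<in> carrier H"
    have "(\<Oplus>\<^bsub>D\<^esub>b\<in>B. \<theta> b \<odot>\<^bsub>D\<^esub> dvec b) h = (\<Oplus>\<^bsub>k\<^esub>b\<in>B. (\<theta> b \<odot>\<^bsub>D\<^esub> dvec b) h)"
      by (rule lin_map_finsum[OF mod_D mod_k dual_eval_lin[OF h] finite_B cl])
    also have "\<dots> = (\<Oplus>\<^bsub>k\<^esub>b\<in>B. dvec b h \<otimes> \<theta> b)"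
      using h \<theta> by (intro K.finsum_cong)
        (auto simp: simp_implies_def dual_simps(6) dual_closed dvec_closed B_closed m_comm)
    also have "\<dots> = \<theta> h" using dual_apply_expand[OF \<theta> h] by simp
    finally show "(\<Oplus>\<^bsub>D\<^esub>b\<in>B. \<theta> b \<odot>\<^bsub>D\<^esub> dvec b) h = \<theta> h" .
  qed (use \<theta> cl in auto)
qed

text \<open>
  For \<open>t = \<theta> \<otimes> n\<close> this is the expansion \<open>\<theta> = \<Sum>\<^sub>b \<theta>(b) b\<^sup>*\<close>, with the scalars moved to \<open>n\<close>. It inverts the
  passage from tensors to linear maps, whence the injectivity in \<open>pairing_ext\<close>.
\<close>

lemma tensor_expand:
  assumes N: "module R N" and t: "t \<in> carrier (tensor R D N)"
  shows "(\<Oplus>\<^bsub>tensor R D N\<^esub>b\<in>B. tens R D N (dvec b) (ev N b t)) = t"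
proof (rule tensor_eqI[OF mod_D N tensor_module[OF mod_D N] _ lin_map_id _ t])
  interpret N: module R N by (rule N)
  interpret D: module R D by (rule mod_D)
  interpret T: module R "tensor R D N" by (rule tensor_module[OF mod_D N])
  show "(\<lambda>t. \<Oplus>\<^bsub>tensor R D N\<^esub>b\<in>B. tens R D N (dvec b) (ev N b t)) \<in> lin_map R (tensor R D N) (tensor R D N)"
    by (intro lin_map_finsum_pointwise tens_lin_right pairing_lin tensor_module mod_D N dvec_closed B_closed)
  fix \<theta> n assume \<theta>: "\<theta> \<in> carrier D" and n: "n \<in> carrier N"
  have cl: "(\<lambda>b. \<theta> b \<odot>\<^bsub>D\<^esub> dvec b) \<in> B \<rightarrow> carrier D"
    using \<theta> by (auto simp: dual_closed B_closed dvec_closed)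
  note l = bilin_left[OF tens_bilin[OF mod_D N]] and r = bilin_right[OF tens_bilin[OF mod_D N]]
  have "(\<Oplus>\<^bsub>tensor R D N\<^esub>b\<in>B. tens R D N (dvec b) (ev N b (tens R D N \<theta> n))) =
      (\<Oplus>\<^bsub>tensor R D N\<^esub>b\<in>B. tens R D N (\<theta> b \<odot>\<^bsub>D\<^esub> dvec b) n)"
    using \<theta> n N by (intro T.finsum_cong)
      (auto simp: simp_implies_def pairing_tens B_closed dual_closed dvec_closed mod_D
        lin_map_smult[OF l] lin_map_smult[OF r])
  also have "\<dots> = tens R D N (\<Oplus>\<^bsub>D\<^esub>b\<in>B. \<theta> b \<odot>\<^bsub>D\<^esub> dvec b) n"
    by (rule lin_map_finsum[OF mod_D T.module_axioms l[OF n] finite_B cl, symmetric])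
  also have "\<dots> = tens R D N \<theta> n" using \<theta> by (simp add: dual_expand)
  finally show "(\<Oplus>\<^bsub>tensor R D N\<^esub>b\<in>B. tens R D N (dvec b) (ev N b (tens R D N \<theta> n))) = tens R D N \<theta> n" .
qed

lemma pairing_ext:
  assumes N: "module R N" and s: "s \<in> carrier (tensor R D N)" and t: "t \<in> carrier (tensor R D N)"
    and eq: "\<And>h. h \<in> carrier H \<Longrightarrow> ev N h s = ev N h t"
  shows "s = t"
proof -
  interpret T: module R "tensor R D N" by (rule tensor_module[OF mod_D N])
  have "(\<Oplus>\<^bsub>tensor R D N\<^esub>b\<in>B. tens R D N (dvec b) (ev N b s)) =
      (\<Oplus>\<^bsub>tensor R D N\<^esub>b\<in>B. tens R D N (dvec b) (ev N b t))"
    by (intro T.finsum_cong) (auto simp: simp_implies_def eq B_closed dvec_closed mod_D N pairing_closed t)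
  then show ?thesis by (simp add: tensor_expand[OF N] s t)
qed

end


section \<open>The comultiplication of the dual\<close>

context fin_dim_hopf_algebra
begin

lemma double_eval_bilin:
  assumes "g \<in> carrier H" "h \<in> carrier H"
  shows "(\<lambda>\<phi> \<psi>. \<phi> g \<otimes> \<psi> h) \<in> bilin R D D k"
  by (intro hopf_lin hopf_mod dual_closed assms)

abbreviation "ev2 g h \<equiv> tlift R D D k (\<lambda>\<phi> \<psi>. \<phi> g \<otimes> \<psi> h)"

lemma ev2_pairing:
  assumes g: "g \<in> carrier H" and h: "h \<in> carrier H" and t: "t \<in> carrier (tensor R D D)"
  shows "ev2 g h t = (ev D g t) h"
proof (rule tensor_eqI[OF mod_D mod_D mod_k _ _ _ t])
  show "ev2 g h \<in> lin_map R (tensor R D D) k"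
    by (intro tlift_lin double_eval_bilin mod_D mod_k g h)
  show "(\<lambda>t. (ev D g t) h) \<in> lin_map R (tensor R D D) k"
    by (rule lin_map_comp[OF pairing_lin dual_eval_lin]) (intro mod_D g h)+
qed (simp add: tlift_tens double_eval_bilin mod_D mod_k g h pairing_tens, simp add: dual_simps h)

lemma ev2_ext:
  assumes "s \<in> carrier (tensor R D D)" "t \<in> carrier (tensor R D D)"
    and "\<And>g h. \<lbrakk>g \<in> carrier H; h \<in> carrier H\<rbrakk> \<Longrightarrow> ev2 g h s = ev2 g h t"
  shows "s = t"
  using assms
  by (intro pairing_ext[OF mod_D] dual_eqI) (auto simp: ev2_pairing pairing_closed mod_D)

text \<open>
  Uniqueness of a tensor with prescribed values \<open>\<theta>\<^sub>1(g) \<theta>\<^sub>2(h)\<close> is injectivity of the pairing in both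
  legs. The tensor \<open>\<Sum>\<^sub>b b\<^sup>* \<otimes> \<theta>(b -)\<close> has these values, because \<open>\<theta>(g h) = \<Sum>\<^sub>b b\<^sup>*(g) \<theta>(b h)\<close>.
\<close>

lemma dual_comult_spec:
  assumes \<theta>: "\<theta> \<in> carrier D"
  shows "dual_comult R H \<theta> \<in> carrier (tensor R D D) \<and>
    (\<forall>g\<in>carrier H. \<forall>h\<in>carrier H. ev2 g h (dual_comult R H \<theta>) = \<theta> (g \<otimes>\<^bsub>H\<^esub> h))"
proof -
  let ?P = "\<lambda>t. t \<in> carrier (tensor R D D) \<and>
    (\<forall>g\<in>carrier H. \<forall>h\<in>carrier H. ev2 g h t = \<theta> (g \<otimes>\<^bsub>H\<^esub> h))"
  interpret K: module R k by (rule mod_k)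
  interpret T: module R "tensor R D D" by (rule tensor_module[OF mod_D mod_D])
  define \<theta>' where "\<theta>' b = (\<lambda>h\<in>carrier H. \<theta> (b \<otimes>\<^bsub>H\<^esub> h))" for b
  have \<theta>': "\<theta>' b \<in> carrier D" if "b \<in> carrier H" for b
    unfolding \<theta>'_def
    by (intro restrict_dual[OF mod_H] dual_apply_lin mult_lin_right alg_H lin_map_id \<theta> that)
  have \<theta>'_apply: "\<theta>' b h = \<theta> (b \<otimes>\<^bsub>H\<^esub> h)" if "h \<in> carrier H" for b h
    using that by (simp add: \<theta>'_def)
  define t where "t = (\<Oplus>\<^bsub>tensor R D D\<^esub>b\<in>B. tens R D D (dvec b) (\<theta>' b))"
  have cl: "(\<lambda>b. tens R D D (dvec b) (\<theta>' b)) \<in> B \<rightarrow> carrier (tensor R D D)"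
    by (auto intro: mod_D dvec_closed \<theta>' B_closed)
  have tcl: "t \<in> carrier (tensor R D D)" unfolding t_def using cl by simp
  have "ev2 g h t = \<theta> (g \<otimes>\<^bsub>H\<^esub> h)" if g: "g \<in> carrier H" and h: "h \<in> carrier H" for g h
  proof -
    \<comment> \<open>Expanding \<open>x \<mapsto> \<theta>(x h)\<close> in the dual basis evaluates the sum.\<close>
    define \<phi> where "\<phi> = (\<lambda>x\<in>carrier H. \<theta> (x \<otimes>\<^bsub>H\<^esub> h))"
    have \<phi>: "\<phi> \<in> carrier D"
      unfolding \<phi>_def
      by (intro restrict_dual[OF mod_H] dual_apply_lin mult_lin_left alg_H lin_map_id \<theta> h)
    have "ev2 g h t = (\<Oplus>\<^bsub>k\<^esub>b\<in>B. ev2 g h (tens R D D (dvec b) (\<theta>' b)))"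
      unfolding t_def
      by (intro lin_map_finsum[OF T.module_axioms mod_k _ finite_B cl] tlift_lin double_eval_bilin
          mod_D mod_k g h)
    also have "\<dots> = (\<Oplus>\<^bsub>k\<^esub>b\<in>B. dvec b g \<otimes> \<phi> b)"
      using g h by (intro K.finsum_cong)
        (auto simp: simp_implies_def tlift_tens double_eval_bilin mod_D mod_k dvec_closed \<theta>' B_closed
          \<phi>_def dual_closed \<theta>'_apply \<theta>)
    also have "\<dots> = \<theta> (g \<otimes>\<^bsub>H\<^esub> h)" using dual_apply_expand[OF \<phi> g] g by (simp add: \<phi>_def)
    finally show ?thesis .
  qed
  with tcl have Pt: "?P t" by blast
  have "s = t" if "?P s" for s
    using that Pt by (intro ev2_ext) auto
  with Pt have "?P (THE t. ?P t)" by (rule theI)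
  then show ?thesis
    by (simp add: dual_comult_def tensor_dual_algebra)
qed

lemma dual_comult_closed: "\<theta> \<in> carrier D \<Longrightarrow> dual_comult R H \<theta> \<in> carrier (tensor R D D)"
  using dual_comult_spec by blast

lemma ev2_dual_comult:
  "\<lbrakk>\<theta> \<in> carrier D; g \<in> carrier H; h \<in> carrier H\<rbrakk> \<Longrightarrow> ev2 g h (dual_comult R H \<theta>) = \<theta> (g \<otimes>\<^bsub>H\<^esub> h)"
  using dual_comult_spec by blast

lemma dual_comult_lin: "dual_comult R H \<in> lin_map R D (tensor R D D)"
proof (rule lin_mapI)
  interpret D: module R D by (rule mod_D)
  interpret T: module R "tensor R D D" by (rule tensor_module[OF mod_D mod_D])
  note lin = tlift_lin[OF mod_D mod_D mod_k double_eval_bilin]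
  show "dual_comult R H (\<theta> \<oplus>\<^bsub>D\<^esub> \<phi>) = dual_comult R H \<theta> \<oplus>\<^bsub>tensor R D D\<^esub> dual_comult R H \<phi>"
    if "\<theta> \<in> carrier D" "\<phi> \<in> carrier D" for \<theta> \<phi>
    by (rule ev2_ext)
      (use that in \<open>simp_all add: dual_comult_closed lin_map_add[OF lin] ev2_dual_comult\<close>,
        simp add: dual_simps)
  show "dual_comult R H (c \<odot>\<^bsub>D\<^esub> \<theta>) = c \<odot>\<^bsub>tensor R D D\<^esub> dual_comult R H \<theta>"
    if "c \<in> carrier R" "\<theta> \<in> carrier D" for c \<theta>
    by (rule ev2_ext)
      (use that in \<open>simp_all add: dual_comult_closed lin_map_smult[OF lin] ev2_dual_comult\<close>,
        simp add: dual_simps)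
qed (rule dual_comult_closed)


section \<open>The canonical element\<close>

text \<open>
  \<open>V\<close> is \<open>\<Sigma>(U)\<close>, and \<open>Vinv\<close> is \<open>\<Sigma>((S \<otimes> id)(U))\<close>.
\<close>

abbreviation "V \<equiv> tens_flip R H D (canonical_element R H)"
abbreviation "Vinv \<equiv> tens_map R D H D H (\<lambda>\<theta>. \<theta>) (antipode H) V"

lemma V_closed: "V \<in> carrier (tensor R D H)"
  and pairing_V: "h \<in> carrier H \<Longrightarrow> ev H h V = h"
proof -
  interpret HD: module R "tensor R H D" by (rule tensor_module[OF mod_H mod_D])
  have cl: "(\<lambda>b. tens R H D b (dvec b)) \<in> B \<rightarrow> carrier (tensor R H D)"
    by (auto intro: mod_D mod_H dvec_closed B_closed)
  have U: "canonical_element R H = (\<Oplus>\<^bsub>tensor R H D\<^esub>b\<in>B. tens R H D b (dvec b))"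
    unfolding canonical_element_def Let_def B_def[symmetric]
    by (intro HD.finsum_cong) (use cl in \<open>auto simp: simp_implies_def dual_vec_dvec\<close>)
  have Ucl: "canonical_element R H \<in> carrier (tensor R H D)"
    unfolding U using cl by simp
  show "V \<in> carrier (tensor R D H)"
    by (rule lin_map_closed[OF tens_flip_lin Ucl]) (intro mod_H mod_D)+
  assume h: "h \<in> carrier H"
  have lin: "(\<lambda>u. ev H h (tens_flip R H D u)) \<in> lin_map R (tensor R H D) H"
    by (intro lin_map_comp[OF tens_flip_lin pairing_lin] mod_H mod_D h)
  have "ev H h V = (\<Oplus>\<^bsub>H\<^esub>b\<in>B. ev H h (tens_flip R H D (tens R H D b (dvec b))))"
    unfolding U by (rule lin_map_finsum[OF HD.module_axioms mod_H lin finite_B cl])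
  also have "\<dots> = (\<Oplus>\<^bsub>H\<^esub>b\<in>B. coord h b \<odot>\<^bsub>H\<^esub> b)"
    using h by (intro M.finsum_cong)
      (auto simp: simp_implies_def tens_flip_tens mod_H mod_D pairing_tens dvec_closed B_closed
        dvec_apply coord_closed)
  also have "\<dots> = h" using h by (rule coord_expand)
  finally show "ev H h V = h" .
qed

lemma Vinv_closed: "Vinv \<in> carrier (tensor R D H)"
  by (rule lin_map_closed[OF tens_map_lin V_closed]) (intro mod_H mod_D lin_map_id antipode_lin)+

lemma pairing_Vinv: "h \<in> carrier H \<Longrightarrow> ev H h Vinv = antipode H h"
  by (simp add: pairing_map mod_H antipode_lin V_closed pairing_V)

lemma DH_algebra: "unital_algebra R (tensor R D H)"
  by (rule unital_algebra_tensor[OF dual_unital_algebra alg_H])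

text \<open>
  Through the pairing, \<open>V\<close> and \<open>Vinv\<close> are the identity and the antipode, which are
  convolution inverses of each other by the antipode axioms.
\<close>

lemma V_inverse:
  "V \<otimes>\<^bsub>tensor R D H\<^esub> Vinv = \<one>\<^bsub>tensor R D H\<^esub>" "Vinv \<otimes>\<^bsub>tensor R D H\<^esub> V = \<one>\<^bsub>tensor R D H\<^esub>"
proof -
  interpret DH: unital_algebra R "tensor R D H" by (rule DH_algebra)
  have S: "antipode H a \<in> carrier H" if "a \<in> carrier H" for a
    using lin_map_closed[OF antipode_lin that] .
  have Slin: "(\<lambda>x. antipode H (f x)) \<in> lin_map R Q H" if "f \<in> lin_map R Q H" for f Q
    by (rule lin_map_comp[OF that antipode_lin])
  have bl: "(\<lambda>a b. a \<otimes>\<^bsub>H\<^esub> antipode H b) \<in> bilin R H H H" "(\<lambda>a b. antipode H a \<otimes>\<^bsub>H\<^esub> b) \<in> bilin R H H H"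
    by (intro bilinI mult_lin_left mult_lin_right Slin S alg_H lin_map_id; assumption)+
  show "V \<otimes>\<^bsub>tensor R D H\<^esub> Vinv = \<one>\<^bsub>tensor R D H\<^esub>"
  proof (rule pairing_ext[OF mod_H])
    fix h assume h: "h \<in> carrier H"
    have "ev H h (V \<otimes>\<^bsub>tensor R D H\<^esub> Vinv) = tlift R H H H (\<lambda>a b. ev H a V \<otimes>\<^bsub>H\<^esub> ev H b Vinv) (\<Delta> h)"
      by (rule pairing_mult[OF alg_H h V_closed Vinv_closed])
    also have "\<dots> = tlift R H H H (\<lambda>a b. a \<otimes>\<^bsub>H\<^esub> antipode H b) (\<Delta> h)"
      by (rule tlift_cong[OF mod_H mod_H comult_closed[OF h] _ mod_H bl(1)])
        (simp add: pairing_V pairing_Vinv)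
    also have "\<dots> = ev H h \<one>\<^bsub>tensor R D H\<^esub>"
      using h by (simp add: antipode_right pairing_one alg_H)
    finally show "ev H h (V \<otimes>\<^bsub>tensor R D H\<^esub> Vinv) = ev H h \<one>\<^bsub>tensor R D H\<^esub>" .
  qed (simp_all add: V_closed Vinv_closed)
  show "Vinv \<otimes>\<^bsub>tensor R D H\<^esub> V = \<one>\<^bsub>tensor R D H\<^esub>"
  proof (rule pairing_ext[OF mod_H])
    fix h assume h: "h \<in> carrier H"
    have "ev H h (Vinv \<otimes>\<^bsub>tensor R D H\<^esub> V) = tlift R H H H (\<lambda>a b. ev H a Vinv \<otimes>\<^bsub>H\<^esub> ev H b V) (\<Delta> h)"
      by (rule pairing_mult[OF alg_H h Vinv_closed V_closed])
    also have "\<dots> = tlift R H H H (\<lambda>a b. antipode H a \<otimes>\<^bsub>H\<^esub> b) (\<Delta> h)"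
      by (rule tlift_cong[OF mod_H mod_H comult_closed[OF h] _ mod_H bl(2)])
        (simp add: pairing_V pairing_Vinv)
    also have "\<dots> = ev H h \<one>\<^bsub>tensor R D H\<^esub>"
      using h by (simp add: antipode_left pairing_one alg_H)
    finally show "ev H h (Vinv \<otimes>\<^bsub>tensor R D H\<^esub> V) = ev H h \<one>\<^bsub>tensor R D H\<^esub>" .
  qed (simp_all add: V_closed Vinv_closed)
qed

lemma inv_V: "inv\<^bsub>tensor R D H\<^esub> V = Vinv"
proof -
  interpret DH: unital_algebra R "tensor R D H" by (rule DH_algebra)
  show ?thesis
    using DH.A.inv_char[OF V_closed Vinv_closed V_inverse] .
qed

end

section \<open>The induced action and the two Yetter--Drinfeld conditions\<close>

locale algebra_with_coactions = fin_dim_hopf_algebra R H + X: unital_algebra R X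
  for R :: "('k, 'r) ring_scheme" (structure)
    and H :: "('k, 'h, 'a) hopf_algebra_scheme" (structure)
    and X :: "('k, 'x, 'b) module_scheme" +
  fixes \<alpha> :: "'x \<Rightarrow> ('k, 'x, 'h) tensor"
    and \<beta> :: "'x \<Rightarrow> ('k, 'h \<Rightarrow> 'k, 'x) tensor"
  assumes right_coact: "right_coaction R H X \<alpha>"
    and left_coact: "left_coaction R (dual R H) X \<beta>"
begin

abbreviation "act \<equiv> induced_action R H X \<beta>"
abbreviation "XH \<equiv> tensor R X H"
abbreviation "A3 \<equiv> tensor R D XH"

lemma mod_X: "module R X" and alg_X: "unital_algebra R X"
  by (rule X.module_axioms, rule X.unital_algebra_axioms)

lemma alg_XH: "unital_algebra R XH"
  by (rule unital_algebra_tensor[OF alg_X alg_H])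

lemma mod_XH: "module R XH"
  by (rule tensor_module[OF mod_X mod_H])

lemma alg_A3: "unital_algebra R A3"
  by (rule unital_algebra_tensor[OF dual_unital_algebra alg_XH])

lemma \<alpha>_lin: "\<alpha> \<in> lin_map R X XH"
  using right_coact by (auto simp: right_coaction_def alg_hom_def)

lemma \<alpha>_closed: "x \<in> carrier X \<Longrightarrow> \<alpha> x \<in> carrier XH"
  using lin_map_closed[OF \<alpha>_lin] .

lemma \<beta>_lin: "\<beta> \<in> lin_map R X (tensor R D X)"
  and \<beta>_mult: "\<lbrakk>x \<in> carrier X; y \<in> carrier X\<rbrakk> \<Longrightarrow> \<beta> (x \<otimes>\<^bsub>X\<^esub> y) = \<beta> x \<otimes>\<^bsub>tensor R D X\<^esub> \<beta> y"
  and \<beta>_one: "\<beta> \<one>\<^bsub>X\<^esub> = \<one>\<^bsub>tensor R D X\<^esub>"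
  and \<beta>_coassoc: "x \<in> carrier X \<Longrightarrow> tens_map R D X D (tensor R D X) (\<lambda>g. g) \<beta> (\<beta> x) =
      tens_assoc R D D X (tens_map R D X (tensor R D D) X (dual_comult R H) (\<lambda>y. y) (\<beta> x))"
  and \<beta>_counit: "x \<in> carrier X \<Longrightarrow> tlift R D X X (\<lambda>g y. g \<one>\<^bsub>H\<^esub> \<odot>\<^bsub>X\<^esub> y) (\<beta> x) = x"
  using left_coact by (auto simp: left_coaction_def alg_hom_def dual_simps(7,8) ring_hom_def)

lemma \<beta>_closed: "x \<in> carrier X \<Longrightarrow> \<beta> x \<in> carrier (tensor R D X)"
  using lin_map_closed[OF \<beta>_lin] .

lemma act_pairing: "act x h = ev X h (\<beta> x)"
  by (rule induced_action_pairing)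

lemma act_lin_left: "h \<in> carrier H \<Longrightarrow> (\<lambda>x. act x h) \<in> lin_map R X X"
  unfolding act_pairing by (intro lin_map_comp[OF \<beta>_lin pairing_lin] mod_X)

lemma act_lin_right: "x \<in> carrier X \<Longrightarrow> (\<lambda>h. act x h) \<in> lin_map R H X"
  unfolding act_pairing by (intro pairing_lin_arg mod_X \<beta>_closed)

lemma act_closed: "\<lbrakk>x \<in> carrier X; h \<in> carrier H\<rbrakk> \<Longrightarrow> act x h \<in> carrier X"
  using lin_map_closed[OF act_lin_left] .

text \<open>
  Both sides arise from coassociativity of \<open>\<beta>\<close> by pairing \<open>g\<close> with the first leg and \<open>h\<close> with the
  second: one side iterates \<open>\<beta>\<close>, the other gives \<open>\<theta>\<^sub>1(g) \<theta>\<^sub>2(h) = \<theta>(g h)\<close>.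
\<close>

lemma act_mult:
  assumes x: "x \<in> carrier X" and g: "g \<in> carrier H" and h: "h \<in> carrier H"
  shows "act x (g \<otimes>\<^bsub>H\<^esub> h) = act (act x g) h"
proof -
  let ?DX = "tensor R D X"
  note DX = tensor_module[OF mod_D mod_X]
  have "act (act x g) h = ev X h (ev ?DX g (tens_map R D X D ?DX (\<lambda>g. g) \<beta> (\<beta> x)))"
    using x g by (simp add: act_pairing pairing_map mod_X DX \<beta>_lin \<beta>_closed)
  also have "\<dots> = ev X h (ev ?DX g (tens_assoc R D D X
      (tens_map R D X (tensor R D D) X (dual_comult R H) (\<lambda>y. y) (\<beta> x))))"
    using x by (simp add: \<beta>_coassoc)
  also have "\<dots> = ev X (g \<otimes>\<^bsub>H\<^esub> h) (\<beta> x)"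
  proof (rule tensor_eqI[OF mod_D mod_X mod_X _ _ _ \<beta>_closed[OF x]])
    show "(\<lambda>t. ev X h (ev ?DX g (tens_assoc R D D X
        (tens_map R D X (tensor R D D) X (dual_comult R H) (\<lambda>y. y) t)))) \<in> lin_map R ?DX X"
      by (intro lin_map_comp[OF tens_map_lin lin_map_comp[OF tens_assoc_lin
            lin_map_comp[OF pairing_lin pairing_lin]]]
          tensor_module mod_D mod_X dual_comult_lin lin_map_id g h)
    show "ev X (g \<otimes>\<^bsub>H\<^esub> h) \<in> lin_map R ?DX X"
      using g h by (intro pairing_lin mod_X) simp
    fix \<theta> y assume \<theta>: "\<theta> \<in> carrier D" and y: "y \<in> carrier X"
    have "ev ?DX g (tens_assoc R D D X
        (tens_map R D X (tensor R D D) X (dual_comult R H) (\<lambda>y. y) (tens R D X \<theta> y))) =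
        tens R D X (ev D g (dual_comult R H \<theta>)) y"
      using \<theta> y g by (simp add: tens_map_tens mod_D mod_X dual_comult_lin lin_map_id pairing_assoc
        dual_comult_closed)
    then show "ev X h (ev ?DX g (tens_assoc R D D X
        (tens_map R D X (tensor R D D) X (dual_comult R H) (\<lambda>y. y) (tens R D X \<theta> y)))) =
        ev X (g \<otimes>\<^bsub>H\<^esub> h) (tens R D X \<theta> y)"
      using \<theta> y g h
      by (simp add: pairing_tens mod_X mod_D pairing_closed dual_comult_closed
          ev2_pairing[symmetric] ev2_dual_comult)
  qed
  finally show ?thesis by (simp add: act_pairing)
qed

lemma induced_action_right_action: "right_action R H X act"
  unfolding right_action_def
proof (intro conjI ballI)
  show "act x \<one>\<^bsub>H\<^esub> = x" if "x \<in> carrier X" for x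
    using \<beta>_counit[OF that] by (simp add: induced_action_def)
  show "act (x \<otimes>\<^bsub>X\<^esub> y) h = tlift R H H X (\<lambda>a b. act x a \<otimes>\<^bsub>X\<^esub> act y b) (\<Delta> h)"
    if "x \<in> carrier X" "y \<in> carrier X" "h \<in> carrier H" for x y h
    using that by (simp add: act_pairing \<beta>_mult pairing_mult alg_X \<beta>_closed)
  show "act \<one>\<^bsub>X\<^esub> h = \<epsilon> h \<odot>\<^bsub>X\<^esub> \<one>\<^bsub>X\<^esub>" if "h \<in> carrier H" for h
    using that by (simp add: act_pairing \<beta>_one pairing_one alg_X)
qed (auto intro: act_lin_left act_lin_right act_mult)

lemma leg13_closed: "v \<in> carrier (tensor R D H) \<Longrightarrow> leg13 R D X H v \<in> carrier A3"
  by (rule lin_map_closed[OF leg13_lin]) (auto intro: mod_D mod_X mod_H)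

text \<open>
  Through the pairing, the embedding into legs 1 and 3 is composition with the algebra map
  \<open>h \<mapsto> 1 \<otimes> h\<close>, which is compatible with convolution.
\<close>

lemma leg13_mult:
  assumes v: "v \<in> carrier (tensor R D H)" and w: "w \<in> carrier (tensor R D H)"
  shows "leg13 R D X H v \<otimes>\<^bsub>A3\<^esub> leg13 R D X H w = leg13 R D X H (v \<otimes>\<^bsub>tensor R D H\<^esub> w)"
proof (rule pairing_ext[OF mod_XH])
  interpret DH: unital_algebra R "tensor R D H" by (rule DH_algebra)
  interpret A3: unital_algebra R A3 by (rule alg_A3)
  note lin = tens_lin_right[OF mod_X mod_H lin_map_id X.A.one_closed]
  fix h assume h: "h \<in> carrier H"
  have "ev XH h (leg13 R D X H v \<otimes>\<^bsub>A3\<^esub> leg13 R D X H w) =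
      tlift R H H XH (\<lambda>a b. ev XH a (leg13 R D X H v) \<otimes>\<^bsub>XH\<^esub> ev XH b (leg13 R D X H w)) (\<Delta> h)"
    by (rule pairing_mult[OF alg_XH h leg13_closed[OF v] leg13_closed[OF w]])
  also have "\<dots> = tlift R H H XH (\<lambda>a b. tens R X H \<one>\<^bsub>X\<^esub> (ev H a v \<otimes>\<^bsub>H\<^esub> ev H b w)) (\<Delta> h)"
    by (rule tlift_cong[OF mod_H mod_H comult_closed[OF h] _ mod_XH
          bilin_comp[OF conv_pairing_bilin[OF alg_H v w] lin]])
      (simp add: pairing_leg13 alg_X mod_H v w tens_mult alg_H pairing_closed)
  also have "\<dots> = tens R X H \<one>\<^bsub>X\<^esub> (ev H h (v \<otimes>\<^bsub>tensor R D H\<^esub> w))"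
    unfolding pairing_mult[OF alg_H h v w]
    by (rule lin_tlift[OF mod_H mod_H mod_H mod_XH conv_pairing_bilin[OF alg_H v w] lin
          comult_closed[OF h], symmetric])
  also have "\<dots> = ev XH h (leg13 R D X H (v \<otimes>\<^bsub>tensor R D H\<^esub> w))"
    using v w h by (simp add: pairing_leg13 alg_X mod_H)
  finally show "ev XH h (leg13 R D X H v \<otimes>\<^bsub>A3\<^esub> leg13 R D X H w) =
      ev XH h (leg13 R D X H (v \<otimes>\<^bsub>tensor R D H\<^esub> w))" .
next
  interpret DH: unital_algebra R "tensor R D H" by (rule DH_algebra)
  interpret A3: unital_algebra R A3 by (rule alg_A3)
  show "leg13 R D X H v \<otimes>\<^bsub>A3\<^esub> leg13 R D X H w \<in> carrier A3"
    using v w by (simp add: leg13_closed)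
  show "leg13 R D X H (v \<otimes>\<^bsub>tensor R D H\<^esub> w) \<in> carrier A3"
    using v w by (simp add: leg13_closed)
qed

lemma leg13_one: "leg13 R D X H \<one>\<^bsub>tensor R D H\<^esub> = \<one>\<^bsub>A3\<^esub>"
  by (simp add: tensor_simps leg13_tens mod_D mod_X mod_H dual_one_closed)

abbreviation "W \<equiv> leg13 R D X H Vinv"
abbreviation "Winv \<equiv> leg13 R D X H V"

lemma W_inverse: "W \<otimes>\<^bsub>A3\<^esub> Winv = \<one>\<^bsub>A3\<^esub>" "Winv \<otimes>\<^bsub>A3\<^esub> W = \<one>\<^bsub>A3\<^esub>"
  by (simp_all add: leg13_mult V_closed Vinv_closed V_inverse leg13_one)

text \<open>
  Multiplying by \<open>V\<^sub>1\<^sub>3\<close> on the left removes the inverse of \<open>V\<close>, and with it the antipode, from the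
  condition.
\<close>

lemma eq_Ad_W_iff:
  assumes l: "l \<in> carrier A3" and m: "m \<in> carrier A3"
  shows "l = Ad A3 W m \<longleftrightarrow> Winv \<otimes>\<^bsub>A3\<^esub> l = m \<otimes>\<^bsub>A3\<^esub> Winv"
proof -
  interpret A3: unital_algebra R A3 by (rule alg_A3)
  note W = leg13_closed[OF Vinv_closed] and Winv = leg13_closed[OF V_closed]
  have inv: "inv\<^bsub>A3\<^esub> W = Winv"
    using A3.A.inv_char[OF W Winv W_inverse] .
  show ?thesis
  proof
    assume "l = Ad A3 W m"
    then have "Winv \<otimes>\<^bsub>A3\<^esub> l = (Winv \<otimes>\<^bsub>A3\<^esub> W) \<otimes>\<^bsub>A3\<^esub> (m \<otimes>\<^bsub>A3\<^esub> Winv)"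
      using W Winv m by (simp add: Ad_def inv A3.A.m_assoc del: W_inverse)
    then show "Winv \<otimes>\<^bsub>A3\<^esub> l = m \<otimes>\<^bsub>A3\<^esub> Winv"
      using Winv m by (simp add: W_inverse)
  next
    assume eq: "Winv \<otimes>\<^bsub>A3\<^esub> l = m \<otimes>\<^bsub>A3\<^esub> Winv"
    have "l = (W \<otimes>\<^bsub>A3\<^esub> Winv) \<otimes>\<^bsub>A3\<^esub> l" using l by (simp add: W_inverse)
    also have "\<dots> = W \<otimes>\<^bsub>A3\<^esub> (m \<otimes>\<^bsub>A3\<^esub> Winv)" using W Winv l by (simp add: A3.A.m_assoc eq)
    also have "\<dots> = Ad A3 W m" using W Winv m by (simp add: Ad_def inv A3.A.m_assoc)
    finally show "l = Ad A3 W m" .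
  qed
qed

lemma pairing_Winv: "h \<in> carrier H \<Longrightarrow> ev XH h Winv = tens R X H \<one>\<^bsub>X\<^esub> h"
  by (simp add: pairing_leg13 alg_X mod_H V_closed pairing_V)

text \<open>
  The tensors \<open>(id \<otimes> \<alpha>)(\<beta>(x))\<close> and \<open>(\<beta> \<otimes> id)(\<alpha>(x))\<close> that the right-left condition relates.
\<close>

abbreviation "lhs x \<equiv> tens_map R D X D XH (\<lambda>\<theta>. \<theta>) \<alpha> (\<beta> x)"
abbreviation "rhs x \<equiv> tens_assoc R D X H (tens_map R X H (tensor R D X) H \<beta> (\<lambda>h. h) (\<alpha> x))"

lemma lhs_closed: "x \<in> carrier X \<Longrightarrow> lhs x \<in> carrier A3"
  by (rule lin_map_closed[OF tens_map_lin]) (auto intro: mod_D mod_X mod_XH lin_map_id \<alpha>_lin \<beta>_closed)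

lemma rhs_lin: "(\<lambda>u. tens_assoc R D X H (tens_map R X H (tensor R D X) H \<beta> (\<lambda>h. h) u)) \<in> lin_map R XH A3"
  by (intro lin_map_comp[OF tens_map_lin tens_assoc_lin] tensor_module mod_D mod_X mod_H \<beta>_lin lin_map_id)

lemma rhs_closed: "x \<in> carrier X \<Longrightarrow> rhs x \<in> carrier A3"
  by (rule lin_map_closed[OF rhs_lin \<alpha>_closed])

lemma pairing_lhs: "\<lbrakk>h \<in> carrier H; x \<in> carrier X\<rbrakk> \<Longrightarrow> ev XH h (lhs x) = \<alpha> (act x h)"
  by (simp add: pairing_map mod_X mod_XH \<alpha>_lin \<beta>_closed act_pairing)

lemma act_tens_bilin: "h \<in> carrier H \<Longrightarrow> (\<lambda>x0 x1. tens R X H (act x0 h) x1) \<in> bilin R X H XH"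
  by (intro bilinI tens_lin_left tens_lin_right act_lin_left act_closed mod_X mod_H lin_map_id; assumption)

lemma pairing_rhs:
  assumes h: "h \<in> carrier H" and x: "x \<in> carrier X"
  shows "ev XH h (rhs x) = tlift R X H XH (\<lambda>x0 x1. tens R X H (act x0 h) x1) (\<alpha> x)"
  by (rule tensor_eqI[OF mod_X mod_H mod_XH lin_map_comp[OF rhs_lin pairing_lin]
        tlift_lin[OF mod_X mod_H mod_XH act_tens_bilin[OF h]] _ \<alpha>_closed[OF x]])
    (simp_all add: mod_XH h tens_map_tens mod_X mod_H mod_D \<beta>_lin lin_map_id pairing_assoc \<beta>_closed
      tlift_tens act_tens_bilin act_pairing[symmetric])

text \<open>The two sides of the right-right Yetter--Drinfeld condition.\<close>

abbreviation "yd_left h x \<equiv> tlift R H H XH (\<lambda>h1 h2.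
  tlift R X H XH (\<lambda>x0 x1. tens R X H (act x0 h1) (x1 \<otimes>\<^bsub>H\<^esub> h2)) (\<alpha> x)) (\<Delta> h)"
abbreviation "yd_right h x \<equiv> tlift R H H XH (\<lambda>h1 h2.
  tlift R X H XH (\<lambda>y0 y1. tens R X H y0 (h1 \<otimes>\<^bsub>H\<^esub> y1)) (\<alpha> (act x h2))) (\<Delta> h)"

text \<open>
  The convolution product of \<open>h \<mapsto> (x\<^sub>0 \<lhd> h) \<otimes> x\<^sub>1\<close> with \<open>h \<mapsto> 1 \<otimes> h\<close>.
\<close>

lemma pairing_rhs_Winv:
  assumes h: "h \<in> carrier H" and x: "x \<in> carrier X"
  shows "ev XH h (rhs x \<otimes>\<^bsub>A3\<^esub> Winv) = yd_left h x"
proof -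
  interpret XH: unital_algebra R XH by (rule alg_XH)
  have mult: "tlift R X H XH (\<lambda>x0 x1. tens R X H (act x0 a) (x1 \<otimes>\<^bsub>H\<^esub> b)) (\<alpha> x) =
      ev XH a (rhs x) \<otimes>\<^bsub>XH\<^esub> ev XH b Winv" if a: "a \<in> carrier H" and b: "b \<in> carrier H" for a b
  proof -
    have lin: "(\<lambda>t. t \<otimes>\<^bsub>XH\<^esub> tens R X H \<one>\<^bsub>X\<^esub> b) \<in> lin_map R XH XH"
      using b by (intro mult_lin_left alg_XH lin_map_id tens_closed mod_X mod_H) auto
    have "ev XH a (rhs x) \<otimes>\<^bsub>XH\<^esub> ev XH b Winv =
        tlift R X H XH (\<lambda>x0 x1. tens R X H (act x0 a) x1 \<otimes>\<^bsub>XH\<^esub> tens R X H \<one>\<^bsub>X\<^esub> b) (\<alpha> x)"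
      unfolding pairing_rhs[OF a x] pairing_Winv[OF b]
      by (rule lin_tlift[OF mod_X mod_H mod_XH mod_XH act_tens_bilin[OF a] lin \<alpha>_closed[OF x]])
    moreover have "tlift R X H XH (\<lambda>x0 x1. tens R X H (act x0 a) (x1 \<otimes>\<^bsub>H\<^esub> b)) (\<alpha> x) = \<dots>"
      by (rule tlift_cong[OF mod_X mod_H \<alpha>_closed[OF x] _ mod_XH
            bilin_comp[OF act_tens_bilin[OF a] lin]])
        (use a b in \<open>simp add: tens_mult alg_X alg_H act_closed\<close>)
    ultimately show ?thesis by simp
  qed
  have "ev XH h (rhs x \<otimes>\<^bsub>A3\<^esub> Winv) =
      tlift R H H XH (\<lambda>a b. ev XH a (rhs x) \<otimes>\<^bsub>XH\<^esub> ev XH b Winv) (\<Delta> h)"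
    by (rule pairing_mult[OF alg_XH h rhs_closed[OF x] leg13_closed[OF V_closed]])
  also have "\<dots> = yd_left h x"
    by (rule tlift_cong[OF mod_H mod_H comult_closed[OF h] mult mod_XH
          conv_pairing_bilin[OF alg_XH rhs_closed[OF x] leg13_closed[OF V_closed]], symmetric])
  finally show ?thesis .
qed

text \<open>
  The convolution product of \<open>h \<mapsto> 1 \<otimes> h\<close> with \<open>h \<mapsto> \<alpha>(x \<lhd> h)\<close>.
\<close>

lemma pairing_Winv_lhs:
  assumes h: "h \<in> carrier H" and x: "x \<in> carrier X"
  shows "ev XH h (Winv \<otimes>\<^bsub>A3\<^esub> lhs x) = yd_right h x"
proof -
  have mult: "tlift R X H XH (\<lambda>y0 y1. tens R X H y0 (a \<otimes>\<^bsub>H\<^esub> y1)) (\<alpha> (act x b)) =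
      ev XH a Winv \<otimes>\<^bsub>XH\<^esub> ev XH b (lhs x)" if a: "a \<in> carrier H" and b: "b \<in> carrier H" for a b
  proof -
    have lin: "(\<lambda>t. tens R X H \<one>\<^bsub>X\<^esub> a \<otimes>\<^bsub>XH\<^esub> t) \<in> lin_map R XH XH"
      using a by (intro mult_lin_right alg_XH lin_map_id tens_closed mod_X mod_H) auto
    have bil: "(\<lambda>y0 y1. tens R X H y0 (a \<otimes>\<^bsub>H\<^esub> y1)) \<in> bilin R X H XH"
      using a by (intro bilinI tens_lin_left tens_lin_right mult_lin_right lin_map_id mod_X mod_H alg_H) auto
    have "tlift R X H XH (\<lambda>y0 y1. tens R X H y0 (a \<otimes>\<^bsub>H\<^esub> y1)) (\<alpha> (act x b)) =
        tens R X H \<one>\<^bsub>X\<^esub> a \<otimes>\<^bsub>XH\<^esub> \<alpha> (act x b)"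
      by (rule tensor_eqI[OF mod_X mod_H mod_XH tlift_lin[OF mod_X mod_H mod_XH bil] lin _
            \<alpha>_closed[OF act_closed[OF x b]]])
        (use a in \<open>simp add: tlift_tens mod_X mod_H mod_XH bil tens_mult alg_X alg_H\<close>)
    then show ?thesis by (simp add: pairing_Winv[OF a] pairing_lhs[OF b x])
  qed
  have "ev XH h (Winv \<otimes>\<^bsub>A3\<^esub> lhs x) =
      tlift R H H XH (\<lambda>a b. ev XH a Winv \<otimes>\<^bsub>XH\<^esub> ev XH b (lhs x)) (\<Delta> h)"
    by (rule pairing_mult[OF alg_XH h leg13_closed[OF V_closed] lhs_closed[OF x]])
  also have "\<dots> = yd_right h x"
    by (rule tlift_cong[OF mod_H mod_H comult_closed[OF h] mult mod_XH
          conv_pairing_bilin[OF alg_XH leg13_closed[OF V_closed] lhs_closed[OF x]], symmetric])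
  finally show ?thesis .
qed

lemma yd_condition_iff:
  assumes x: "x \<in> carrier X"
  shows "lhs x = Ad A3 W (rhs x) \<longleftrightarrow> (\<forall>h\<in>carrier H. yd_left h x = yd_right h x)"
proof -
  interpret A3: unital_algebra R A3 by (rule alg_A3)
  note cl = lhs_closed[OF x] rhs_closed[OF x] leg13_closed[OF V_closed]
  have "lhs x = Ad A3 W (rhs x) \<longleftrightarrow> Winv \<otimes>\<^bsub>A3\<^esub> lhs x = rhs x \<otimes>\<^bsub>A3\<^esub> Winv"
    by (rule eq_Ad_W_iff[OF cl(1,2)])
  also have "\<dots> \<longleftrightarrow> (\<forall>h\<in>carrier H. ev XH h (Winv \<otimes>\<^bsub>A3\<^esub> lhs x) = ev XH h (rhs x \<otimes>\<^bsub>A3\<^esub> Winv))"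
    using pairing_ext[OF mod_XH, of "Winv \<otimes>\<^bsub>A3\<^esub> lhs x" "rhs x \<otimes>\<^bsub>A3\<^esub> Winv"] cl by force
  also have "\<dots> \<longleftrightarrow> (\<forall>h\<in>carrier H. yd_left h x = yd_right h x)"
    using x by (auto simp: pairing_Winv_lhs pairing_rhs_Winv)
  finally show ?thesis .
qed

lemma right_left_YD_iff_YD: "right_left_YD_algebra R H X \<alpha> \<beta> \<longleftrightarrow> YD_algebra R H X act \<alpha>"
  using yd_condition_iff
  by (simp add: right_left_YD_algebra_def YD_algebra_def Let_def inv_V right_coact left_coact
      induced_action_right_action) blast

end

theorem proposition4p24:
  fixes R :: "('k, 'r) ring_scheme"
    and H :: "('k, 'h, 'a) hopf_algebra_scheme"
    and X :: "('k, 'x, 'b) module_scheme"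
    and \<alpha> :: "'x \<Rightarrow> ('k, 'x, 'h) tensor"
    and \<beta> :: "'x \<Rightarrow> ('k, 'h \<Rightarrow> 'k, 'x) tensor"
  assumes "field R"
    and "hopf_algebra R H"
    and "finite_dimensional R H"
    and "unital_algebra R X"
    and "right_coaction R H X \<alpha>"
    and "left_coaction R (dual R H) X \<beta>"
  shows "right_action R H X (induced_action R H X \<beta>) \<and>
    (right_left_YD_algebra R H X \<alpha> \<beta> \<longleftrightarrow>
     YD_algebra R H X (induced_action R H X \<beta>) \<alpha>)"
proof -
  interpret algebra_with_coactions R H X \<alpha> \<beta>
    by (intro algebra_with_coactions.intro fin_dim_hopf_algebra.intro fin_dim_hopf_algebra_axioms.intro
        algebra_with_coactions_axioms.intro assms)
  show ?thesis
    using induced_action_right_action right_left_YD_iff_YD by blast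
qed

end
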